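(* There are $C \in \mathbb{R}_{>0}$ and $\rho \in (0,1)$ such that the following two statements hold. (1) For all integers $r \geq 0$ and for all $j \in \{1,2\}$, $$\|\mu_r(\text{Pell}_j) - \pi_{\text{C.L.}}\|_1 \leq C \cdot \rho^r.$$ (2) For all integers $r \geq 0$ and for all $a,b \in \mathbb{F}_2$, $$\|\mu_r(\text{Pell}_3,(a,b)) - \pi_{\text{C.L.}}\|_1 \leq C \cdot \rho^r.$$
   Context: Write $[n] = \{1,\dots,n\}$. For $A \in \text{Mat}_{\mathbb{F}_2}([n]\times[n])$, $v,w \in \mathbb{F}_2^{[n]}$ and $c \in \mathbb{F}_2$, let $A(v,w,c)$ be the $(n+1)\times(n+1)$ matrix over $\mathbb{F}_2$ whose $(i,j)$ entry is $A(i,j)$ if $i,j \in [n]$, $v(j)$ if $i=n+1$ and $j\in[n]$, $w(i)$ if $j=n+1$ and $i \in [n]$, and $c$ if $i=j=n+1$. A rule is a product space $\mathcal{S} = \prod_{i\in\mathbb{Z}_{\geq 0}} S_i$ with each $S_i$ a non-empty subset of $\mathbb{F}_2^{[i]}\times\mathbb{F}_2^{[i]}\times\mathbb{F}_2$ (for $i=0$ this set is identified with $\mathbb{F}_2$). It is a probability space with the product of the uniform measures on the $S_i$. To $B = ((v_i,w_i,c_i))_{i\ge 0} \in \mathcal{S}$ one attaches matrices $\omega_i(B) \in \text{Mat}_{\mathbb{F}_2}([i]\times[i])$: $\omega_0(B)$ is the empty matrix and $\omega_{i+1}(B) = \omega_i(B)(v_i,w_i,c_i)$. The associated random variables are $X_i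 : \mathcal{S}\to\{0,\dots,i\}$, $B\mapsto \text{co-rk}(\omega_i(B))$, where $\text{co-rk}$ is the dimension of the kernel. Let $H_i \in \mathbb{F}_2^{[i]}$ be the all-ones vector, and let $\pi_j$ denote projection on the $j$-th coordinate. Below $\kappa$ is a non-negative integer, and $(v,w,c)$ ranges over $\mathbb{F}_2^{[i]} \times \mathbb{F}_2^{[i]} \times \mathbb{F}_2$. The rule $\mathcal{S}_{\text{Pell},1}(\kappa) = \prod_i S_i(\text{Pell}_1,\kappa)$: $S_0(\text{Pell}_1,\kappa)=\{1\}$; for $1\le i<\kappa$, $$S_i(\text{Pell}_1,\kappa) = \{(v,w,c) : v+w=(0,H_{i-1}),\ \pi_1(w)=1\};$$ for $i\ge\kappa$ (and $i \geq 1$), $$S_i(\text{Pell}_1,\kappa)=\{(v,w,c): v=w,\ \pi_1(v)=0\}.$$ Here $(0,H_{i-1})$ is the vector with first coordinate $0$ and all other coordinates $1$. The rule $\mathcal{S}_{\text{Pell},2}(\kappa) = \prod_i S_i(\text{Pell}_2,\kappa)$: $S_0(\text{Pell}_2,\kappa)=\{1\}$; for $1\le i\le\kappa$, $$S_i(\text{Pell}_2,\kappa) = \{(v,w,c) : v+w=H_i,\ \pi_1(w)=1\};$$ for $i>\kappa$ (and $i\ge 1$), $$S_i(\text{Pell}_2,\kappa)=\{(v,w,c): v=w,\ \pi_1(v)=0\}.$$ For $a,b\in\mathbb{F}_2$, the rule $\mathcal{S}_{\text{Pell},3}(\kappa,(a,b)) = \prod_i S_i(\text{Pell}_3,(a,b),\kappa)$: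 $S_0=\{1\}$, $S_1=\{(1,a,b)\}$; for $2\le i\le\kappa$, $$S_i(\text{Pell}_3,(a,b),\kappa)=\{(v,w,c): \pi_1(v)=0,\ \pi_1(w)=1,\ \pi_2(v)=1,\ \pi_j(v)+\pi_j(w)=1 \text{ for } 3\le j \leq i\};$$ for $i\ge 2$ with $i>\kappa$, $$S_i(\text{Pell}_3,(a,b),\kappa)=\{(v,w,c): \pi_1(w)=1,\ \pi_1(v)=0,\ \pi_2(v)=0,\ \pi_j(v)+\pi_j(w)=0 \text{ for } 3\le j \leq i\}.$$ The corresponding corank random variables are denoted $X_i(\text{Pell}_1,\kappa)$, $X_i(\text{Pell}_2,\kappa)$, $X_i(\text{Pell}_3,(a,b),\kappa)$. For a random variable $X$ with values in $\mathbb{Z}_{\ge0}$, $\mu_X(j)=\mathbb{P}(X=j)$. With $\text{Binom}(r,\kappa) = 2^{-r}\binom{r}{\kappa}$, for each integer $r\ge 0$ put $$\mu_r(\text{Pell}_j) = \sum_{\kappa=0}^r \text{Binom}(r,\kappa)\,\mu_{X_r(\text{Pell}_j,\kappa)} \quad (j\in\{1,2\}),$$ $$\mu_r(\text{Pell}_3,(a,b)) = \sum_{\kappa=0}^{r-1}\text{Binom}(r-1,\kappa)\,\mu_{X_r(\text{Pell}_3,(a,b),\kappa)}$$ (for $r=0$ the last sum is empty, i.e. the zero function). For $k \in \mathbb{Z}_{\geq 0} \cup \{\infty\}$ put $\eta_k(t) := \prod_{j=1}^k (1 - t^{-j})$, and let $\pi_{\text{C.L.}}(j) = 2^{-j^2}\eta_\infty(2)\eta_j(2)^{-2}$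 for $j \in \mathbb{Z}_{\ge 0}$. For $f:\mathbb{Z}_{\ge0}\to\mathbb{R}$, $\|f\|_1=\sum_{j\ge0}|f(j)|$. *)

theory Defs
  imports
    "HOL-Probability.Probability"
    "HOL-Library.Z2"
    "Jordan_Normal_Form.Matrix_Kernel"
begin

unbundle no vec_syntax

text \<open>
  The field of two elements is the type \<^typ>\<open>bit\<close>.  Vectors and matrices are those of
  \<^theory>\<open>Jordan_Normal_Form.Matrix\<close>, hence indexed from 0: the informal coordinate or index
  \<open>j\<close> in \<open>[n] = {1, ..., n}\<close> is \<open>j - 1\<close> below, and \<open>\<pi>\<^sub>j(v)\<close> is \<open>v $ (j - 1)\<close>.
\<close>

text \<open>The matrix \<open>A(v,w,c)\<close>: \<open>v\<close> is the new last row, \<open>w\<close> the new last column.\<close>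

definition extend_mat :: "bit mat \<Rightarrow> bit vec \<Rightarrow> bit vec \<Rightarrow> bit \<Rightarrow> bit mat" where
  "extend_mat A v w c =
     (let n = dim_row A in
      mat (n + 1) (n + 1) (\<lambda>(i, j).
        if i < n \<and> j < n then A $$ (i, j)
        else if i = n \<and> j < n then v $ j
        else if i < n \<and> j = n then w $ i
        else c))"

type_synonym step = "bit vec \<times> bit vec \<times> bit"

text \<open>A rule is given by its sequence of factors \<open>S\<^sub>i\<close>.\<close>

definition is_rule :: "(nat \<Rightarrow> step set) \<Rightarrow> bool" where
  "is_rule S \<longleftrightarrow> (\<forall>i. S i \<noteq> {} \<and> S i \<subseteq> carrier_vec i \<times> carrier_vec i \<times> UNIV)"

definition rule_space :: "(nat \<Rightarrow> step set) \<Rightarrow> (nat \<Rightarrow> step) measure" where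
  "rule_space S = Pi\<^sub>M UNIV (\<lambda>i. uniform_count_measure (S i))"

primrec omega :: "nat \<Rightarrow> (nat \<Rightarrow> step) \<Rightarrow> bit mat" where
  "omega 0 B = mat 0 0 (\<lambda>_. 0)"
| "omega (Suc i) B = (case B i of (v, w, c) \<Rightarrow> extend_mat (omega i B) v w c)"

definition corank_rv :: "nat \<Rightarrow> (nat \<Rightarrow> step) \<Rightarrow> nat" where
  "corank_rv i B = kernel_dim (omega i B)"

text \<open>The distribution \<open>\<mu>\<close> of the \<open>i\<close>-th corank random variable of the rule \<open>S\<close>.\<close>

definition corank_dist :: "(nat \<Rightarrow> step set) \<Rightarrow> nat \<Rightarrow> nat \<Rightarrow> real" where
  "corank_dist S i j = \<P>(B in rule_space S. corank_rv i B = j)"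

text \<open>
  The Pell rules.  The factor \<open>S\<^sub>0 = {1}\<close> lives in \<open>the field\<close>, identified with triples whose
  two vectors are empty.
\<close>

definition Pell1 :: "nat \<Rightarrow> nat \<Rightarrow> step set" where
  "Pell1 \<kappa> i =
     (if i = 0 then {(0\<^sub>v 0, 0\<^sub>v 0, 1)}
      else if i < \<kappa> then
        {(v, w, c). v \<in> carrier_vec i \<and> w \<in> carrier_vec i \<and>
           v + w = vec i (\<lambda>j. if j = 0 then 0 else 1) \<and> w $ 0 = 1}
      else
        {(v, w, c). v \<in> carrier_vec i \<and> w \<in> carrier_vec i \<and> v = w \<and> v $ 0 = 0})"

definition Pell2 :: "nat \<Rightarrow> nat \<Rightarrow> step set" where
  "Pell2 \<kappa> i =
     (if i = 0 then {(0\<^sub>v 0, 0\<^sub>v 0, 1)}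
      else if i \<le> \<kappa> then
        {(v, w, c). v \<in> carrier_vec i \<and> w \<in> carrier_vec i \<and>
           v + w = vec i (\<lambda>_. 1) \<and> w $ 0 = 1}
      else
        {(v, w, c). v \<in> carrier_vec i \<and> w \<in> carrier_vec i \<and> v = w \<and> v $ 0 = 0})"

definition Pell3 :: "bit \<Rightarrow> bit \<Rightarrow> nat \<Rightarrow> nat \<Rightarrow> step set" where
  "Pell3 a b \<kappa> i =
     (if i = 0 then {(0\<^sub>v 0, 0\<^sub>v 0, 1)}
      else if i = 1 then {(vec 1 (\<lambda>_. 1), vec 1 (\<lambda>_. a), b)}
      else if i \<le> \<kappa> then
        {(v, w, c). v \<in> carrier_vec i \<and> w \<in> carrier_vec i \<and>
           v $ 0 = 0 \<and> w $ 0 = 1 \<and> v $ 1 = 1 \<and> (\<forall>j\<in>{2..<i}. v $ j + w $ j = 1)}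
      else
        {(v, w, c). v \<in> carrier_vec i \<and> w \<in> carrier_vec i \<and>
           w $ 0 = 1 \<and> v $ 0 = 0 \<and> v $ 1 = 0 \<and> (\<forall>j\<in>{2..<i}. v $ j + w $ j = 0)})"

lemma is_rule_Pell1: "is_rule (Pell1 \<kappa>)"
proof -
  have "Pell1 \<kappa> i \<noteq> {}" for i
  proof -
    consider "i = 0" | "0 < i" "i < \<kappa>" | "0 < i" "\<kappa> \<le> i" by linarith
    then show ?thesis
    proof cases
      case 2
      then have "(vec i (\<lambda>_. 1), vec i (\<lambda>j. if j = 0 then 1 else 0), 0)
                   \<in> Pell1 \<kappa> i"
        by (auto simp: Pell1_def intro!: eq_vecI)
      then show ?thesis by blast
    next
      case 3
      then have "(0\<^sub>v i, 0\<^sub>v i, 0) \<in> Pell1 \<kappa> i" by (auto simp: Pell1_def)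
      then show ?thesis by blast
    qed (simp add: Pell1_def)
  qed
  then show ?thesis by (auto simp: is_rule_def Pell1_def split: if_splits)
qed

lemma is_rule_Pell2: "is_rule (Pell2 \<kappa>)"
proof -
  have "Pell2 \<kappa> i \<noteq> {}" for i
  proof -
    consider "i = 0" | "0 < i" "i \<le> \<kappa>" | "0 < i" "\<kappa> < i" by linarith
    then show ?thesis
    proof cases
      case 2
      then have "(0\<^sub>v i, vec i (\<lambda>_. 1), 0) \<in> Pell2 \<kappa> i" by (auto simp: Pell2_def)
      then show ?thesis by blast
    next
      case 3
      then have "(0\<^sub>v i, 0\<^sub>v i, 0) \<in> Pell2 \<kappa> i" by (auto simp: Pell2_def)
      then show ?thesis by blast
    qed (simp add: Pell2_def)
  qed
  then show ?thesis by (auto simp: is_rule_def Pell2_def split: if_splits)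
qed

lemma is_rule_Pell3: "is_rule (Pell3 a b \<kappa>)"
proof -
  have "Pell3 a b \<kappa> i \<noteq> {}" for i
  proof -
    consider "i = 0" | "i = 1" | "2 \<le> i" "i \<le> \<kappa>" | "2 \<le> i" "\<kappa> < i" by linarith
    then show ?thesis
    proof cases
      case 3
      then have "(vec i (\<lambda>j. if j = 1 then 1 else 0), vec i (\<lambda>_. 1), 0) \<in> Pell3 a b \<kappa> i"
        by (auto simp: Pell3_def)
      then show ?thesis by blast
    next
      case 4
      then have "(0\<^sub>v i, vec i (\<lambda>j. if j = 0 then 1 else 0), 0) \<in> Pell3 a b \<kappa> i"
        by (auto simp: Pell3_def)
      then show ?thesis by blast
    qed (simp_all add: Pell3_def)
  qed
  then show ?thesis by (auto simp: is_rule_def Pell3_def split: if_splits)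
qed

definition Binom :: "nat \<Rightarrow> nat \<Rightarrow> real" where
  "Binom r \<kappa> = real (r choose \<kappa>) / 2 ^ r"

definition mu_Pell1 :: "nat \<Rightarrow> nat \<Rightarrow> real" where
  "mu_Pell1 r j = (\<Sum>\<kappa>=0..r. Binom r \<kappa> * corank_dist (Pell1 \<kappa>) r j)"

definition mu_Pell2 :: "nat \<Rightarrow> nat \<Rightarrow> real" where
  "mu_Pell2 r j = (\<Sum>\<kappa>=0..r. Binom r \<kappa> * corank_dist (Pell2 \<kappa>) r j)"

text \<open>The range \<open>\<kappa> < r\<close>, rather than \<open>\<kappa> \<le> r - 1\<close>, makes the sum empty for \<open>r = 0\<close>.\<close>

definition mu_Pell3 :: "bit \<Rightarrow> bit \<Rightarrow> nat \<Rightarrow> nat \<Rightarrow> real" where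
  "mu_Pell3 a b r j = (\<Sum>\<kappa><r. Binom (r - 1) \<kappa> * corank_dist (Pell3 a b \<kappa>) r j)"

definition eta :: "enat \<Rightarrow> real \<Rightarrow> real" where
  "eta k t = (case k of
      enat n \<Rightarrow> (\<Prod>j=1..n. 1 - t powi (- int j))
    | \<infinity> \<Rightarrow> (\<Prod>j. 1 - t powi (- int (Suc j))))"

definition pi_CL :: "nat \<Rightarrow> real" where
  "pi_CL j = 2 powi (- (int j ^ 2)) * eta \<infinity> 2 * eta (enat j) 2 powi (- 2)"

text \<open>Extended-valued, so that a bound on it includes absolute summability.\<close>

definition l1_norm :: "(nat \<Rightarrow> real) \<Rightarrow> ennreal" where
  "l1_norm f = (\<Sum>j. ennreal \<bar>f j\<bar>)"

end

theory Submission
  imports Defs "HOL-Library.Function_Algebras"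
begin

text \<open>
  Since the corner entry is \<open>1\<close>, passing to its Schur complement turns each rule into a uniformly random
  matrix \<open>M\<close> for which \<open>M + M\<^sup>T\<close> is prescribed on (almost) all indices: it is the alternating form
  \<open>\<Sum> y\<^sub>i z\<^sub>j\<close> over \<open>i \<noteq> j\<close> in an index set \<open>K\<close> with about \<open>\<kappa>\<close> elements.  Independent vectors
  \<open>z\<^sub>1, \<dots>, z\<^sub>k\<close> can lie in the kernel of \<open>M\<close> only if they are isotropic for this form, and then they do so
  with a probability depending only on \<open>k\<close>.  The radical of the form has codimension at least \<open>card K - 1\<close>, so
  counting isotropic tuples shows that the expected number of injections of a \<open>k\<close>-dimensional space into
  the kernel is \<open>1\<close> up to an error \<open>O (2 powr (k\<^sup>2 / 2 - card K / 2))\<close>.  The Cohen-Lenstra distribution is the one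
  for which all these moments are \<open>1\<close>; the moments determine a distribution by an explicit inversion
  formula, whose coefficients decay fast enough to absorb the factor \<open>2 powr (k\<^sup>2 / 2)\<close>.  Averaging the
  resulting bound \<open>O (2 powr (- \<kappa> / 2))\<close> over binomially distributed \<open>\<kappa>\<close> gives the exponential rate.
\<close>

section \<open>Euler's identity and inversion of the moments\<close>

text \<open>The proof rests on a balance of exponents with almost no room. After the inversion, an
  error 2 powr (k^2/2) in the moment of order \<open>k = j + m\<close> leaves only 2 powr (-m/2) for
  the series over \<open>m\<close>, and 2 powr (-j^2/2) for the norm. The obstacle is degenerate
  tuples: a tuple dependent modulo the radical may have far more isotropic extensions than a generic
  one, and the weight \<open>2 ^ tri_num k\<close> amplifies this. Their share is at most 1 and at
  most 2 powr (k + 1 - card K). The first bound does not see \<open>K\<close>; the second costs an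
  extra factor 2 powr (k/2), which ruins the series over \<open>m\<close>. Their geometric mean just
  fits, and it is the reason why the decay is in powers of 1 / sqrt 2 and not of 1/2.

  No convergence problem arises on the side of the matrices, because the corank is bounded by the
  size and its inversion formula is a finite sum. On the side of the limit law only the sum of the
  inversion coefficients is required, and Euler's identity evaluates it.\<close>

definition qpoch :: "nat \<Rightarrow> real" where
  "qpoch n = (\<Prod>i<n. 1 - (1/2) ^ Suc i)"

lemma qpoch_0 [simp]: "qpoch 0 = 1"
  and qpoch_Suc: "qpoch (Suc n) = qpoch n * (1 - (1/2) ^ Suc n)"
  by (simp_all add: qpoch_def)

text \<open>The bound 1/4 alone does not survive the induction, since each step multiplies by 1 - x
  with x = (1/2)^(n+2). The added term pays for this: (1/4 + x)(1 - x) \<ge> 1/4 + x/2 as long as x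
  \<le> 1/4.\<close>

lemma qpoch_ge: "qpoch (Suc n) \<ge> 1/4 + (1/2) ^ (n + 2)"
proof (induction n)
  case (Suc n)
  define x :: real where "x = (1/2) ^ (n + 2)"
  have x: "0 \<le> x" "x \<le> 1/4"
    using power_decreasing[of 2 "n + 2" "1/2::real"] by (auto simp: x_def power2_eq_square)
  have "1/4 + x / 2 \<le> (1/4 + x) * (1 - x)"
  proof -
    have "x * x \<le> x / 4"
      using mult_right_mono[of x "1/4" x] x by simp
    moreover have "(1/4 + x) * (1 - x) = 1/4 + 3/4 * x - x * x"
      by (simp add: field_simps)
    ultimately show ?thesis
      using x by linarith
  qed
  also have "\<dots> \<le> qpoch (Suc n) * (1 - x)"
    using Suc x by (intro mult_right_mono) (auto simp: x_def)
  also have "\<dots> = qpoch (Suc (Suc n))"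
    by (simp add: qpoch_Suc[of "Suc n"] x_def)
  finally show ?case
    by (simp add: x_def)
qed (simp add: qpoch_def power2_eq_square)

lemma qpoch_ge_quarter: "qpoch n \<ge> 1/4"
proof (cases n)
  case (Suc m)
  then show ?thesis
  proof -
    have "0 \<le> (1/2::real) ^ (m + 2)"
      by simp
    then show ?thesis
      using qpoch_ge[of m] unfolding Suc by linarith
  qed
qed simp

lemma qpoch_pos [simp]: "qpoch n > 0"
  using qpoch_ge_quarter[of n] by linarith

lemma qpoch_neq_0 [simp]: "qpoch n \<noteq> 0"
  using qpoch_pos[of n] by linarith

section \<open>Euler's series for the tails of the infinite product\<close>

definition tri_num :: "nat \<Rightarrow> nat" where
  "tri_num n = (\<Sum>i<n. i)"

lemma tri_num_0 [simp]: "tri_num 0 = 0"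
  and tri_num_Suc [simp]: "tri_num (Suc n) = tri_num n + n"
  by (simp_all add: tri_num_def)

lemma twice_triangle: "2 * tri_num n + n = n * n"
  by (induction n) auto

text \<open>With q = 1/2, this is the term of degree \<open>m\<close> in Euler's expansion of the
  product of 1 - q^i over i > n.\<close>

definition euler_term :: "nat \<Rightarrow> nat \<Rightarrow> real" where
  "euler_term n m = (-1) ^ m * (1/2) ^ (tri_num m + m + n * m) / qpoch m"

lemma euler_term_0 [simp]: "euler_term n 0 = 1"
  by (simp add: euler_term_def)

lemma abs_euler_term_le: "\<bar>euler_term n m\<bar> \<le> 4 * (1/2) ^ (tri_num m + m + n * m)"
proof -
  have "inverse (qpoch m) \<le> 4"
    using le_imp_inverse_le[OF qpoch_ge_quarter[of m]] by simp
  then have "(1/2) ^ (tri_num m + m + n * m) * inverse (qpoch m) \<le> (1/2) ^ (tri_num m + m + n * m) * 4"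
    by (intro mult_left_mono) auto
  moreover have "\<bar>euler_term n m\<bar> = (1/2) ^ (tri_num m + m + n * m) * inverse (qpoch m)"
    by (simp add: euler_term_def abs_mult power_abs abs_of_pos inverse_eq_divide)
  ultimately show ?thesis
    by (simp only: mult.commute)
qed

lemma abs_euler_term_le_geometric: "\<bar>euler_term n m\<bar> \<le> 4 * (1/2) ^ m"
proof -
  have "(1/2::real) ^ (tri_num m + m + n * m) \<le> (1/2) ^ m"
    by (rule power_decreasing) auto
  then show ?thesis
    using abs_euler_term_le[of n m] by linarith
qed

lemma summable_euler_term: "summable (euler_term n)"
  by (rule summable_comparison_test'[where N = 0 and g = "\<lambda>m. 4 * (1/2::real) ^ m"])
     (auto intro!: summable_mult summable_geometric abs_euler_term_le_geometric)

definition euler_sum :: "nat \<Rightarrow> real" where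
  "euler_sum n = (\<Sum>m. euler_term n m)"

text \<open>Passing from n to n + 1 drops the first factor of the product. Termwise, the difference
  at index \<open>Suc m\<close> produces the factor 1 - q^(m+1), which cancels the last factor of
  \<open>qpoch (Suc m)\<close> and leaves a multiple of the term of index \<open>m\<close>.\<close>

lemma euler_sum_rec: "euler_sum n = (1 - (1/2) ^ Suc n) * euler_sum (Suc n)"
proof -
  have step: "euler_term n (Suc m) - euler_term (Suc n) (Suc m) = - ((1/2) ^ Suc n * euler_term (Suc n) m)" for m
  proof -
    define y where "y = ((-1) ^ m * (1/2) ^ (tri_num m + 2 * m + n * m + n + 1) :: real)"
    define u :: real where "u = (1/2) ^ Suc m"
    have "u < 1"
      unfolding u_def by (rule power_Suc_less_one) auto
    have e1:"tri_num (Suc m) + Suc m + n * Suc m = tri_num m + 2 * m + n * m + n + 1"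
      and e2: "tri_num (Suc m) + Suc m + Suc n * Suc m = (tri_num m + 2 * m + n * m + n + 1) + Suc m"
      and e3: "tri_num m + 2 * m + n * m + n + 1 = Suc n + (tri_num m + m + Suc n * m)"
      by simp_all
    have "euler_term n (Suc m) = - y / (qpoch m * (1 - u))"
      unfolding euler_term_def qpoch_Suc u_def[symmetric] e1 by (simp add: y_def)
    moreover have "euler_term (Suc n) (Suc m) = - (y * u) / (qpoch m * (1 - u))"
      unfolding euler_term_def qpoch_Suc u_def[symmetric] e2 power_add[of _ _ "Suc m"]
      by (simp add: y_def)
    ultimately have "euler_term n (Suc m) - euler_term (Suc n) (Suc m) = - y * (1 - u) / (qpoch m * (1 - u))"
      by (simp add: diff_divide_distrib right_diff_distrib)
    also have "\<dots> = - (y / qpoch m)"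
      using \<open>u < 1\<close> by simp
    also have "y = (1/2) ^ Suc n * ((-1) ^ m * (1/2) ^ (tri_num m + m + Suc n * m))"
      unfolding y_def e3 by (simp only: power_add mult.left_commute)
    also have "- (\<dots> / qpoch m) = - ((1/2) ^ Suc n * euler_term (Suc n) m)"
      unfolding euler_term_def by simp
    finally show ?thesis .
  qed
  have "euler_sum n - euler_sum (Suc n) = (\<Sum>m. euler_term n m - euler_term (Suc n) m)"
    unfolding euler_sum_def by (rule suminf_diff) (rule summable_euler_term)+
  also have "\<dots> = (\<Sum>m. euler_term n (Suc m) - euler_term (Suc n) (Suc m))"
    by (subst suminf_split_head) (auto intro!: summable_diff summable_euler_term)
  also have "\<dots> = - ((1/2) ^ Suc n * euler_sum (Suc n))"
    unfolding step euler_sum_def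
    by (intro sums_unique[symmetric] sums_minus sums_mult summable_sums summable_euler_term)
  finally show ?thesis
    by (simp add: algebra_simps)
qed

lemma qpoch_euler_sum: "qpoch n * euler_sum n = euler_sum 0"
proof (induction n)
  case (Suc n)
  then show ?case
    by (metis euler_sum_rec mult.assoc qpoch_Suc)
qed simp

text \<open>All terms but the leading 1 carry a factor (1/2)^n. Hence the second factor in
  \<open>qpoch n * euler_sum n = euler_sum 0\<close> disappears in the limit, which identifies the
  infinite product.\<close>

lemma euler_sum_tendsto: "euler_sum \<longlonglongrightarrow> 1"
proof -
  have bound: "norm (euler_sum n - 1) \<le> 4 * (1/2) ^ n" for n
  proof -
    have *: "norm (euler_term n (Suc m)) \<le> 4 * (1/2) ^ n * (1/2) ^ Suc m" for m
    proof -
      have "(1/2::real) ^ (tri_num (Suc m) + Suc m + n * Suc m) \<le> (1/2) ^ (n + Suc m)"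
        by (intro power_decreasing) auto
      also have "\<dots> = (1/2) ^ n * (1/2) ^ Suc m"
        by (rule power_add)
      finally show ?thesis
        using abs_euler_term_le[of n "Suc m"] unfolding real_norm_def by linarith
    qed
    have sm: "summable (\<lambda>m. 4 * (1/2::real) ^ n * (1/2) ^ Suc m)"
      by (intro summable_mult) (simp add: summable_geometric)
    have "euler_sum n - 1 = (\<Sum>m. euler_term n (Suc m))"
      unfolding euler_sum_def by (subst suminf_split_head) (auto simp: summable_euler_term)
    also have "norm \<dots> \<le> (\<Sum>m. 4 * (1/2) ^ n * (1/2) ^ Suc m)"
      by (rule norm_suminf_le[OF * sm])
    also have "\<dots> = 4 * (1/2) ^ n * (\<Sum>m. (1/2) ^ Suc m)"
      by (rule suminf_mult) (simp add: summable_geometric)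
    also have "(\<Sum>m. (1/2::real) ^ Suc m) = 1"
      using power_half_series by (rule sums_unique[symmetric])
    finally show ?thesis by simp
  qed
  have "(\<lambda>n. 4 * (1/2::real) ^ n) \<longlonglongrightarrow> 0"
    by (intro tendsto_mult_right_zero LIMSEQ_power_zero) auto
  then have "(\<lambda>n. euler_sum n - 1) \<longlonglongrightarrow> 0"
    by (rule Lim_null_comparison[OF always_eventually[OF allI[OF bound]]])
  then show ?thesis
    by (simp add: LIM_zero_iff)
qed

lemma qpoch_tendsto: "qpoch \<longlonglongrightarrow> euler_sum 0"
proof -
  have ev: "\<forall>\<^sub>F n in sequentially. euler_sum 0 / euler_sum n = qpoch n"
  proof -
    have "\<forall>\<^sub>F n in sequentially. euler_sum n > 0"
      by (rule order_tendstoD(1)[OF euler_sum_tendsto]) simp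
    then show ?thesis
    proof eventually_elim
    case (elim n)
    then have "euler_sum 0 / euler_sum n = (qpoch n * euler_sum n) / euler_sum n"
      by (simp only: qpoch_euler_sum)
    then show ?case
      using elim by simp
    qed
  qed
  have "(\<lambda>n. euler_sum 0 / euler_sum n) \<longlonglongrightarrow> euler_sum 0 / 1"
    by (intro tendsto_divide tendsto_const euler_sum_tendsto) simp
  then show ?thesis
    using tendsto_cong[OF ev] by simp
qed

lemma two_powi_minus: "2 powi (- int n) = (1/2 :: real) ^ n"
  by (simp only: power_int_minus power_int_of_nat) (simp add: power_one_over inverse_eq_divide)

lemma eta_enat: "eta (enat n) 2 = qpoch n"
  unfolding eta_def qpoch_def two_powi_minus enat.case
  by (simp add: prod.atLeast1_atMost_eq del: power_Suc)

lemma eta_infinity: "eta \<infinity> 2 = euler_sum 0"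
proof -
  let ?f = "\<lambda>j. 1 - 2 powi (- int (Suc j)) :: real"
  have f: "?f j = 1 - (1/2) ^ Suc j" for j
    by (rule arg_cong[OF two_powi_minus])
  have "(\<lambda>n. \<Prod>i\<le>n. ?f i) = (\<lambda>n. qpoch (Suc n))"
    by (simp add: f qpoch_def lessThan_Suc_atMost del: of_nat_Suc)
  moreover have "(\<lambda>n. qpoch (Suc n)) \<longlonglongrightarrow> euler_sum 0"
    by (rule LIMSEQ_Suc[OF qpoch_tendsto])
  \<comment> \<open>\<open>has_prod\<close> without zero factors requires a nonzero limit; the
    uniform bound 1/4 on \<open>qpoch\<close> provides it.\<close>
  moreover have "euler_sum 0 \<noteq> 0"
    using LIMSEQ_le_const[OF qpoch_tendsto, of "1/4"] qpoch_ge_quarter by fastforce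
  ultimately have "?f has_prod euler_sum 0"
    unfolding has_prod_def raw_has_prod_def by simp
  then show ?thesis
    unfolding eta_def by (simp add: has_prod_iff del: of_nat_Suc)
qed

text \<open>Moebius inversion on the lattice of subspaces: multiplied by
  \<open>inj_count (j + m) x\<close>, the coefficient is the number of flags with dimensions
  \<open>j\<close> and \<open>j + m\<close> in dimension \<open>x\<close>, times the Moebius value
  (-1)^m 2^(m(m-1)/2).\<close>

definition inversion_coeff :: "nat \<Rightarrow> nat \<Rightarrow> real" where
  "inversion_coeff j m = (1/2) ^ (j * j) / qpoch j * euler_term j m"

text \<open>This is the inversion formula at moments all equal to 1, and the only form in which the
  moments of \<open>pi_CL\<close> enter: their own series are never summed.\<close>

lemma inversion_coeff_sums: "inversion_coeff j sums pi_CL j"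
proof -
  have "inversion_coeff j sums ((1/2) ^ (j * j) / qpoch j * euler_sum j)"
    unfolding inversion_coeff_def euler_sum_def
    by (intro sums_mult summable_sums summable_euler_term)
  also have "(1/2) ^ (j * j) / qpoch j * euler_sum j = pi_CL j"
  proof -
    have 1: "(2::real) powi (- (int j ^ 2)) = (1/2) ^ (j * j)"
      by (simp only: power2_eq_square two_powi_minus flip: of_nat_mult)
    have 2: "qpoch j powi (- 2) = 1 / (qpoch j * qpoch j)"
      by (simp add: power_int_minus power2_eq_square inverse_eq_divide)
    show ?thesis
      unfolding pi_CL_def eta_enat eta_infinity qpoch_euler_sum[of j, symmetric] 1 2 by simp
  qed
  finally show ?thesis .
qed

text \<open>The number of injective linear maps from dimension \<open>k\<close> to dimension \<open>x\<close> over the field with two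
  elements.\<close>

definition inj_count :: "nat \<Rightarrow> nat \<Rightarrow> real" where
  "inj_count k x = (\<Prod>i<k. 2 ^ x - 2 ^ i)"

lemma inj_count_0 [simp]: "inj_count 0 x = 1"
  and inj_count_Suc: "inj_count (Suc k) x = inj_count k x * (2 ^ x - 2 ^ k)"
  by (simp_all add: inj_count_def)

lemma inj_count_eq_0: "x < k \<Longrightarrow> inj_count k x = 0"
  by (auto simp: inj_count_def)

text \<open>An injection from dimension j + m is an injection on the first j basis vectors followed
  by one of the rest into the quotient of dimension n, where each of the m remaining images has
  \<open>2 ^ j\<close> lifts.\<close>

lemma inj_count_add: "inj_count (j + m) (j + n) = inj_count j (j + n) * 2 ^ (j * m) * inj_count m n"
proof (induction m)
  case (Suc m)
  have "inj_count (j + Suc m) (j + n) = inj_count (j + m) (j + n) * (2 ^ j * (2 ^ n - 2 ^ m))"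
    by (simp add: inj_count_Suc power_add right_diff_distrib)
  then show ?case
    unfolding Suc.IH by (simp add: inj_count_Suc power_add)
qed simp

lemma inj_count_self: "inj_count j j = 2 ^ (j * j) * qpoch j"
proof -
  have "inj_count j j = (\<Prod>i<j. 2 ^ j - 2 ^ (j - Suc i))"
    unfolding inj_count_def by (rule prod.nat_diff_reindex[symmetric])
  also have "\<dots> = (\<Prod>i<j. 2 ^ j * (1 - (1/2) ^ Suc i))"
  proof (rule prod.cong)
    fix i assume "i \<in> {..<j}"
    then have "(2::real) ^ (j - Suc i) = 2 ^ j / 2 ^ Suc i"
      by (subst power_diff) auto
    then show "(2::real) ^ j - 2 ^ (j - Suc i) = 2 ^ j * (1 - (1/2) ^ Suc i)"
      by (simp only: power_one_over right_diff_distrib) simp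
  qed simp
  also have "\<dots> = 2 ^ (j * j) * qpoch j"
    by (simp add: prod.distrib qpoch_def power_mult)
  finally show ?thesis .
qed

text \<open>Having a closed form for every partial sum lets the induction run. At
  \<open>M = n > 0\<close> the product contains the factor \<open>2 ^ n - 2 ^ n\<close>, so the sum
  vanishes: the q-analogue of (1 - 1)^n = 0.\<close>

lemma alternating_sum_telescope:
  "(\<Sum>m\<le>M. euler_term 0 m * inj_count m n)
     = euler_term 0 M * (\<Prod>i<M. 2 ^ n - 2 ^ Suc i)"
proof (induction M)
  case (Suc M)
  define P :: real where "P = (\<Prod>i<M. 2 ^ n - 2 ^ Suc i)"
  have shift: "inj_count (Suc M) n = (2 ^ n - 1) * P"
    unfolding inj_count_def P_def by (subst prod.lessThan_Suc_shift) simp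
  define u v a :: real where "u = (1/2) ^ Suc M" and "v = 2 ^ Suc M" and "a = (-1) ^ M * (1/2) ^ (tri_num M + M)"
  have "u < 1"
    unfolding u_def by (rule power_Suc_less_one) auto
  have vu: "(v - 1) * u = 1 - u"
    unfolding u_def v_def left_diff_distrib by (simp only: power_mult_distrib[symmetric]) simp
  have "tri_num (Suc M) + Suc M + 0 * Suc M = tri_num M + M + Suc M"
    by simp
  then have "euler_term 0 (Suc M) = - (a * u) / (qpoch M * (1 - u))"
    unfolding euler_term_def qpoch_Suc a_def u_def by (simp only: power_add) simp
  then have "- (v - 1) * euler_term 0 (Suc M) = a * ((v - 1) * u) / (qpoch M * (1 - u))"
    by (simp add: algebra_simps diff_divide_distrib)
  also have "\<dots> = euler_term 0 M"
    unfolding vu using \<open>u < 1\<close> by (simp add: euler_term_def a_def)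
  finally have e: "euler_term 0 M = - (v - 1) * euler_term 0 (Suc M)" ..
  have alg: "- (v - 1) * E * P + E * ((y - 1) * P) = E * (P * (y - v))" for E y
    by (simp add: algebra_simps)
  show ?case
    unfolding sum.atMost_Suc Suc.IH shift prod.lessThan_Suc P_def[symmetric] v_def[symmetric] e
    by (rule alg)
next
  case 0
  show ?case
    by (simp only: atMost_0 lessThan_0) simp
qed

lemma inversion:
  assumes "x \<le> M"
  shows "(\<Sum>m\<le>M. inversion_coeff j m * inj_count (j + m) x) = of_bool (x = j)"
proof (cases "j \<le> x")
  case False
  then show ?thesis
    by (simp add: inj_count_eq_0)
next
  case True
  then obtain n where n: "x = j + n"
    using le_Suc_ex by blast
  have e: "euler_term j m * 2 ^ (j * m) = euler_term 0 m" for m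
    by (simp add: euler_term_def power_add power_one_over)
  have "(\<Sum>m\<le>M. inversion_coeff j m * inj_count (j + m) x)
      = (\<Sum>m\<le>n. inversion_coeff j m * inj_count (j + m) x)"
    using assms by (intro sum.mono_neutral_right) (auto simp: n inj_count_eq_0)
  also have "\<dots> = (1/2) ^ (j * j) / qpoch j * inj_count j x * (\<Sum>m\<le>n. euler_term 0 m * inj_count m n)"
    unfolding sum_distrib_left n inj_count_add inversion_coeff_def e[symmetric]
    by (intro sum.cong) auto
  also have "(\<Sum>m\<le>n. euler_term 0 m * inj_count m n) = of_bool (n = 0)"
    unfolding alternating_sum_telescope
    by (cases n) auto
  finally show ?thesis
    by (auto simp: n inj_count_self power_one_over)
qed

section \<open>Linear algebra over the field with two elements\<close>

declare add_bit_eq_xor [simp del] mult_bit_eq_and [simp del]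

lemma bit_add_self [simp]: "x + x = 0" for x :: bit
  by (cases x) auto

lemma bit_add_left_self [simp]: "x + (x + y) = y" for x y :: bit
  by (simp flip: add.assoc)

lemma bit_add_eq_0_iff: "x + y = 0 \<longleftrightarrow> x = y" for x y :: bit
  by (metis add_cancel_right_right bit_add_left_self)

text \<open>Induction leaves \<open>0\<close> at function types in \<open>\<eta>\<close>-long form, which \<open>zero_fun_apply\<close> turns into
  a constant abstraction.\<close>

lemma const_zero_fun [simp]: "(\<lambda>_. 0) = (0 :: 'a \<Rightarrow> 'b::zero)"
  by (simp add: zero_fun_def)

lemma bit_fun_add_self [simp]: "x + x = 0" for x :: "'a \<Rightarrow> bit"
  by (simp add: fun_eq_iff)

lemma bit_fun_add_left_self [simp]: "x + (x + y) = y" for x y :: "'a \<Rightarrow> bit"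
  by (simp add: fun_eq_iff)

lemma bit_fun_add_eq_0_iff: "x + y = 0 \<longleftrightarrow> x = y" for x y :: "'a \<Rightarrow> bit"
  by (simp add: fun_eq_iff bit_add_eq_0_iff)

type_synonym bvec = "nat \<Rightarrow> bit"

text \<open>For vectors over the field with two elements, closure under addition already means being
  a subspace.\<close>

definition additive_set :: "'a::monoid_add set \<Rightarrow> bool" where
  "additive_set U \<longleftrightarrow> 0 \<in> U \<and> (\<forall>x\<in>U. \<forall>y\<in>U. x + y \<in> U)"

definition bit_sign :: "bit \<Rightarrow> int" where
  "bit_sign b = (if b = 0 then 1 else - 1)"

lemma bit_sign_add: "bit_sign (a + b) = bit_sign a * bit_sign b"
  by (cases a; cases b) (auto simp: bit_sign_def)

text \<open>Orthogonality of characters: translation by some \<open>u0\<close> with value 1 permutes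
  \<open>U\<close> and flips every sign.\<close>

lemma sum_bit_sign:
  fixes \<phi> :: "'a::ab_group_add \<Rightarrow> bit"
  assumes "finite U" "additive_set U" and add: "\<And>x y. \<phi> (x + y) = \<phi> x + \<phi> y"
  shows "(\<Sum>u\<in>U. bit_sign (\<phi> u)) = (if \<forall>u\<in>U. \<phi> u = 0 then int (card U) else 0)"
proof (cases "\<forall>u\<in>U. \<phi> u = 0")
  case True
  then show ?thesis
    by (simp add: bit_sign_def)
next
  case False
  then obtain u0 where u0: "u0 \<in> U" "\<phi> u0 = 1"
    by auto
  have "inj_on (\<lambda>u. u + u0) U" "(\<lambda>u. u + u0) ` U \<subseteq> U"
    using assms(2) u0 by (auto simp: inj_on_def additive_set_def)
  then have "bij_betw (\<lambda>u. u + u0) U U"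
    using endo_inj_surj[OF assms(1)] by (auto simp: bij_betw_def)
  then have "(\<Sum>u\<in>U. bit_sign (\<phi> u)) = (\<Sum>u\<in>U. bit_sign (\<phi> (u + u0)))"
    by (rule sum.reindex_bij_betw[symmetric])
  also have "\<dots> = - (\<Sum>u\<in>U. bit_sign (\<phi> u))"
    by (simp add: add u0 bit_sign_add sum_negf flip: sum_distrib_right) (simp add: bit_sign_def)
  finally have "(\<Sum>u\<in>U. bit_sign (\<phi> u)) = 0"
    by simp
  then show ?thesis
    using False by (simp only: if_False)
qed

text \<open>Double counting: both sides are the sum of the signs of \<open>\<beta> b u\<close> over all pairs.\<close>

lemma card_annihilator:
  fixes \<beta> :: "'a::ab_group_add \<Rightarrow> 'b::ab_group_add \<Rightarrow> bit"
  assumes U: "finite U" "additive_set U" and V: "finite V" "additive_set V"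
    and l: "\<And>x y u. \<beta> (x + y) u = \<beta> x u + \<beta> y u"
    and r: "\<And>x u v. \<beta> x (u + v) = \<beta> x u + \<beta> x v"
  shows "card {b \<in> V. \<forall>u\<in>U. \<beta> b u = 0} * card U = card V * card {u \<in> U. \<forall>b\<in>V. \<beta> b u = 0}"
proof -
  have *: "(\<Sum>x\<in>A. if P x then c else 0) = int (card {x \<in> A. P x}) * c" if "finite A"
    for A :: "'c set" and P c
    using that by (simp add: sum.If_cases Int_def)
  have "(\<Sum>b\<in>V. \<Sum>u\<in>U. bit_sign (\<beta> b u)) = int (card {b \<in> V. \<forall>u\<in>U. \<beta> b u = 0} * card U)"
    by (simp add: sum_bit_sign[OF U r] * V)
  moreover have "(\<Sum>b\<in>V. \<Sum>u\<in>U. bit_sign (\<beta> b u)) = (\<Sum>u\<in>U. \<Sum>b\<in>V. bit_sign (\<beta> b u))"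
    by (rule sum.swap)
  moreover have "\<dots> = int (card {u \<in> U. \<forall>b\<in>V. \<beta> b u = 0} * card V)"
    by (simp add: sum_bit_sign[OF V l] * U)
  ultimately show ?thesis
    by (simp only: of_nat_eq_iff mult.commute)
qed

text \<open>Vectors are functions on all of \<open>nat\<close> that vanish outside \<open>X\<close>,
  so that vectors over \<open>X\<close>, \<open>Y\<close> and \<open>X - Y\<close> share one type
  and no index is ever renumbered.\<close>

definition vecs :: "nat set \<Rightarrow> bvec set" where
  "vecs X = {x. \<forall>i. i \<notin> X \<longrightarrow> x i = 0}"

lemma additive_vecs [simp]: "additive_set (vecs X)"
  by (simp add: additive_set_def vecs_def)

lemma vecs_add [intro]: "x \<in> vecs X \<Longrightarrow> y \<in> vecs X \<Longrightarrow> x + y \<in> vecs X"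
  by (simp add: vecs_def)

lemma zero_in_vecs [simp]: "0 \<in> vecs X"
  by (simp add: vecs_def)

lemma vecs_mono: "X \<subseteq> Y \<Longrightarrow> vecs X \<subseteq> vecs Y"
  by (auto simp: vecs_def)

lemma bij_betw_vecs: "bij_betw (\<lambda>x. {i. x i = 1}) (vecs X) (Pow X)"
proof (rule bij_betw_byWitness[where f' = "\<lambda>S i. of_bool (i \<in> S)"])
  show "\<forall>x\<in>vecs X. (\<lambda>i. of_bool (i \<in> {i. x i = 1})) = x"
  proof (intro ballI ext)
    fix x :: bvec and i
    show "of_bool (i \<in> {i. x i = 1}) = x i"
      by (cases "x i") auto
  qed
qed (auto simp: vecs_def; metis zero_neq_one)+

lemma finite_vecs [simp]: "finite X \<Longrightarrow> finite (vecs X)"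
  using bij_betw_finite[OF bij_betw_vecs] by simp

lemma card_vecs: "finite X \<Longrightarrow> card (vecs X) = 2 ^ card X"
  using bij_betw_same_card[OF bij_betw_vecs[of X]] by (simp add: card_Pow)

definition dotp :: "nat set \<Rightarrow> bvec \<Rightarrow> bvec \<Rightarrow> bit" where
  "dotp X x y = (\<Sum>i\<in>X. x i * y i)"

lemma dotp_add_left: "dotp X (x + y) z = dotp X x z + dotp X y z"
  and dotp_add_right: "dotp X z (x + y) = dotp X z x + dotp X z y"
  by (simp_all add: dotp_def distrib_left distrib_right sum.distrib)

lemma dotp_commute: "dotp X x y = dotp X y x"
  by (simp add: dotp_def mult.commute)

lemma dotp_eq_0_imp:
  assumes "finite X" "\<And>b. b \<in> vecs X \<Longrightarrow> dotp X b u = 0" "i \<in> X"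
  shows "u i = 0"
proof -
  have "dotp X (\<lambda>j. of_bool (j = i)) u = (\<Sum>j\<in>X. if j = i then u i else 0)"
    unfolding dotp_def by (intro sum.cong) auto
  also have "\<dots> = u i"
    using assms by simp
  finally show ?thesis
    using assms(2)[of "\<lambda>j. of_bool (j = i)"] assms(3) by (auto simp: vecs_def)
qed

section \<open>Spans, independence and counting of tuples\<close>

fun spn :: "bvec list \<Rightarrow> bvec set" where
  "spn [] = {0}"
| "spn (z # zs) = spn zs \<union> (+) z ` spn zs"

lemma finite_spn [simp]: "finite (spn zs)"
  by (induction zs) auto

lemma zero_in_spn [simp]: "0 \<in> spn zs"
  by (induction zs) auto

lemma additive_spn [simp]: "additive_set (spn zs)"
proof (induction zs)
  case (Cons z zs)
  have "x + y \<in> spn (z # zs)" if "x \<in> spn (z # zs)" "y \<in> spn (z # zs)" for x y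
  proof -
    have *: "u + v \<in> spn zs" if "u \<in> spn zs" "v \<in> spn zs" for u v
      using Cons that by (simp add: additive_set_def)
    have "z + u + (z + v) = u + v" "u + (z + v) = z + (u + v)" "z + u + v = z + (u + v)" for u v
      by (simp_all only: add.assoc add.left_commute[of u z] bit_fun_add_left_self)
    note e = this
    have "x \<in> spn zs \<or> (\<exists>u\<in>spn zs. x = z + u)" "y \<in> spn zs \<or> (\<exists>u\<in>spn zs. y = z + u)"
      using that by auto
    then have "x + y \<in> spn zs \<or> (\<exists>u\<in>spn zs. x + y = z + u)"
      using e * by (elim disjE bexE) metis+
    then show ?thesis
      by auto
  qed
  then show ?case
    by (simp add: additive_set_def)
qed (simp add: additive_set_def)

lemma spn_subset: "additive_set W \<Longrightarrow> set zs \<subseteq> W \<Longrightarrow> spn zs \<subseteq> W"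
  by (induction zs) (auto simp: additive_set_def)

lemma set_subset_spn: "set zs \<subseteq> spn zs"
proof (induction zs)
  case (Cons z zs)
  have "z + 0 \<in> (+) z ` spn zs"
    by (rule imageI) simp
  then show ?case
    using Cons by auto
qed simp

lemma additive_vanish_spn:
  fixes \<phi> :: "bvec \<Rightarrow> bit"
  assumes "\<And>x y. \<phi> (x + y) = \<phi> x + \<phi> y"
  shows "(\<forall>u\<in>spn zs. \<phi> u = 0) \<longleftrightarrow> (\<forall>z\<in>set zs. \<phi> z = 0)"
proof
  have "\<phi> 0 = 0"
    using assms[of 0 0] by simp
  then show "\<forall>z\<in>set zs. \<phi> z = 0 \<Longrightarrow> \<forall>u\<in>spn zs. \<phi> u = 0"
    by (induction zs) (auto simp: assms)
qed (use set_subset_spn in auto)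

text \<open>Linear independence modulo a subspace \<open>R\<close>; in characteristic 2, \<open>z + u\<close> is also \<open>z - u\<close>.\<close>

fun indep :: "bvec set \<Rightarrow> bvec list \<Rightarrow> bool" where
  "indep R [] \<longleftrightarrow> True"
| "indep R (z # zs) \<longleftrightarrow> indep R zs \<and> (\<forall>u\<in>spn zs. z + u \<notin> R)"

lemma indep_spn_inter:
  assumes "indep R zs" "additive_set R" "u \<in> spn zs" "u \<in> R"
  shows "u = 0"
  using assms by (induction zs) auto

lemma card_spn_le: "card (spn zs) \<le> 2 ^ length zs"
proof (induction zs)
  case (Cons z zs)
  have "card (spn (z # zs)) \<le> card (spn zs) + card ((+) z ` spn zs)"
    by (simp add: card_Un_le)
  also have "card ((+) z ` spn zs) \<le> card (spn zs)"
    by (rule card_image_le) simp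
  finally show ?case
    using Cons by simp
qed simp

text \<open>A vector common to both halves of the span would give z + (u + v) = 0 with u + v in the
  old span, and 0 lies in \<open>R\<close>.\<close>

lemma card_spn:
  assumes "indep R zs" "0 \<in> R"
  shows "card (spn zs) = 2 ^ length zs"
  using assms
proof (induction zs)
  case (Cons z zs)
  have False if "z + u = v" "u \<in> spn zs" "v \<in> spn zs" for u v
  proof -
    have "u + v \<in> spn zs"
      using additive_spn[of zs] that by (simp add: additive_set_def)
    then have "z + (u + v) \<notin> R"
      using Cons by simp
    then show False
      using that Cons by (simp flip: add.assoc)
  qed
  then have "spn zs \<inter> (+) z ` spn zs = {}"
    by auto
  then have "card (spn (z # zs)) = card (spn zs) + card ((+) z ` spn zs)"
    by (simp add: card_Un_disjoint)
  also have "card ((+) z ` spn zs) = card (spn zs)"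
    by (rule card_image) (simp add: inj_on_def)
  finally show ?case
    using Cons by simp
qed simp

lemma card_dependent_le:
  assumes "finite R" "finite V"
  shows "card {z \<in> V. \<exists>u\<in>spn zs. z + u \<in> R} \<le> 2 ^ length zs * card R"
proof -
  have "{z \<in> V. \<exists>u\<in>spn zs. z + u \<in> R} \<subseteq> (\<lambda>(u, r). u + r) ` (spn zs \<times> R)"
  proof safe
    fix z u assume "u \<in> spn zs" "z + u \<in> R"
    moreover have "z = u + (z + u)"
      by (simp add: fun_eq_iff algebra_simps)
    ultimately show "z \<in> (\<lambda>(u, r). u + r) ` (spn zs \<times> R)"
      by force
  qed
  then have "card {z \<in> V. \<exists>u\<in>spn zs. z + u \<in> R} \<le> card ((\<lambda>(u, r). u + r) ` (spn zs \<times> R))"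
    using assms by (intro card_mono) auto
  also have "\<dots> \<le> card (spn zs \<times> R)"
    using assms by (intro card_image_le) auto
  also have "\<dots> \<le> 2 ^ length zs * card R"
    by (simp add: card_cartesian_product card_spn_le)
  finally show ?thesis .
qed

definition klists :: "nat \<Rightarrow> 'a set \<Rightarrow> 'a list set" where
  "klists k V = {zs. length zs = k \<and> set zs \<subseteq> V}"

lemma klists_0 [simp]: "klists 0 V = {[]}"
  by (auto simp: klists_def)

lemma finite_klists [simp]: "finite V \<Longrightarrow> finite (klists k V)"
  using finite_lists_length_eq[of V k] by (simp add: klists_def conj_commute)

lemma card_klists: "finite V \<Longrightarrow> card (klists k V) = card V ^ k"
  using card_lists_length_eq[of V k] by (simp add: klists_def conj_commute)

lemma card_klists_Suc:
  assumes "finite V"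
  shows "card {zs \<in> klists (Suc k) V. P zs} = (\<Sum>zs\<in>klists k V. card {z \<in> V. P (z # zs)})"
proof -
  have "bij_betw (\<lambda>(zs, z). z # zs) (SIGMA zs:klists k V. {z \<in> V. P (z # zs)}) {zs \<in> klists (Suc k) V. P zs}"
    by (rule bij_betw_byWitness[where f' = "\<lambda>zs. (tl zs, hd zs)"])
       (auto simp: klists_def length_Suc_conv)
  then have "card {zs \<in> klists (Suc k) V. P zs} = card (SIGMA zs:klists k V. {z \<in> V. P (z # zs)})"
    by (rule bij_betw_same_card[symmetric])
  then show ?thesis
    using assms by simp
qed

text \<open>Injections are recorded as the images of a basis, that is as independent lists: a new
  entry must avoid the span of the earlier ones, which has \<open>2 ^ k\<close> elements.\<close>

lemma card_indep_klists:
  assumes W: "finite W" "additive_set W" "card W = 2 ^ x"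
  shows "real (card {zs \<in> klists k W. indep {0} zs}) = inj_count k x"
proof (induction k)
  case 0
  have "{zs. zs = ([] :: bvec list) \<and> indep {0} zs} = {[]}"
    by auto
  then show ?case
    by simp
next
  case (Suc k)
  have "real (card {z \<in> W. indep {0} (z # zs)}) = of_bool (indep {0} zs) * (2 ^ x - 2 ^ k)"
    if "zs \<in> klists k W" for zs
  proof (cases "indep {0} zs")
    case True
    have sub: "spn zs \<subseteq> W"
      using that W by (intro spn_subset) (auto simp: klists_def)
    have "{z \<in> W. indep {0} (z # zs)} = W - spn zs"
      using True by (auto simp: bit_fun_add_eq_0_iff)
    moreover have "card (spn zs) \<le> card W"
      using card_mono[OF W(1) sub] .
    ultimately have "real (card {z \<in> W. indep {0} (z # zs)}) = real (card W) - real (card (spn zs))"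
      using sub by (simp only: card_Diff_subset[OF finite_spn] of_nat_diff)
    also have "card (spn zs) = 2 ^ k"
      using card_spn[OF True] that by (simp add: klists_def)
    finally show ?thesis
      using True W by simp
  qed simp
  then have "real (card {zs \<in> klists (Suc k) W. indep {0} zs})
      = (\<Sum>zs\<in>klists k W. of_bool (indep {0} zs) * (2 ^ x - 2 ^ k))"
    using W by (simp add: card_klists_Suc)
  also have "\<dots> = real (card {zs \<in> klists k W. indep {0} zs}) * (2 ^ x - 2 ^ k)"
    using W by (simp add: Int_def flip: sum_distrib_right)
  finally show ?case
    using Suc by (simp add: inj_count_Suc)
qed

section \<open>Random matrices with a prescribed alternating part\<close>

definition mulv :: "nat set \<Rightarrow> (nat \<Rightarrow> nat \<Rightarrow> bit) \<Rightarrow> bvec \<Rightarrow> bvec" where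
  "mulv X M x = (\<lambda>i. if i \<in> X then \<Sum>j\<in>X. M i j * x j else 0)"

lemma mulv_in_vecs [simp]: "mulv X M x \<in> vecs X"
  by (simp add: mulv_def vecs_def)

lemma mulv_add_left: "mulv X (M + M') x = mulv X M x + mulv X M' x"
  and mulv_add_right: "mulv X M (x + y) = mulv X M x + mulv X M y"
  by (simp_all add: mulv_def fun_eq_iff distrib_left distrib_right sum.distrib)

lemma mulv_zero [simp]: "mulv X M 0 = 0"
  by (simp add: mulv_def fun_eq_iff)

lemma mulv_cong: "(\<And>i j. i \<in> X \<Longrightarrow> j \<in> X \<Longrightarrow> M i j = M' i j) \<Longrightarrow> mulv X M x = mulv X M' x"
  by (auto simp: mulv_def fun_eq_iff intro!: sum.cong)

definition kern :: "nat set \<Rightarrow> (nat \<Rightarrow> nat \<Rightarrow> bit) \<Rightarrow> bvec set" where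
  "kern X M = {x \<in> vecs X. mulv X M x = 0}"

lemma additive_kern: "additive_set (kern X M)"
  by (auto simp: additive_set_def kern_def mulv_add_right)

text \<open>This is \<open>b w\<^sup>T + w b\<^sub>Y\<^sup>T + c w w\<^sup>T\<close> with \<open>b\<^sub>Y\<close> the restriction of \<open>b\<close> to \<open>Y\<close>.  If \<open>w\<close> is orthogonal on \<open>Y\<close> to some
  vectors but has product \<open>1\<close> with \<open>z\<close>, and \<open>b\<close> is orthogonal to the same vectors, then for a suitable \<open>c\<close>
  the matrix annihilates these vectors and maps \<open>z\<close> to \<open>b\<close>.\<close>

definition symm :: "nat set \<Rightarrow> bvec \<Rightarrow> bvec \<Rightarrow> bit \<Rightarrow> nat \<Rightarrow> nat \<Rightarrow> bit" where
  "symm Y b w c = (\<lambda>i j. b i * w j + w i * (if j \<in> Y then b j else 0) + c * w i * w j)"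

lemma sum_vecs_restrict:
  assumes "finite X" "Y \<subseteq> X" "w \<in> vecs Y"
  shows "(\<Sum>j\<in>X. w j * f j) = (\<Sum>j\<in>Y. w j * f j)"
  using assms by (intro sum.mono_neutral_right) (auto simp: vecs_def)

lemma mulv_symm:
  assumes "finite X" "Y \<subseteq> X" "w \<in> vecs Y" "b \<in> vecs X"
  shows "mulv X (symm Y b w c) x i = b i * dotp Y w x + w i * dotp Y b x + c * w i * dotp Y w x"
proof (cases "i \<in> X")
  case True
  have 1: "(\<Sum>j\<in>X. w j * x j) = dotp Y w x"
    unfolding dotp_def by (rule sum_vecs_restrict[OF assms(1-3)])
  have "(\<Sum>j\<in>X. (if j \<in> Y then b j else 0) * x j) = (\<Sum>j\<in>Y. (if j \<in> Y then b j else 0) * x j)"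
    using assms by (intro sum.mono_neutral_right) auto
  also have "\<dots> = dotp Y b x"
    unfolding dotp_def by (intro sum.cong) auto
  finally have 2: "(\<Sum>j\<in>X. (if j \<in> Y then b j else 0) * x j) = dotp Y b x" .
  have "mulv X (symm Y b w c) x i
      = (\<Sum>j\<in>X. b i * (w j * x j) + w i * ((if j \<in> Y then b j else 0) * x j) + c * w i * (w j * x j))"
    using True unfolding mulv_def symm_def by (simp add: distrib_right mult.assoc)
  also have "\<dots> = b i * dotp Y w x + w i * dotp Y b x + c * w i * dotp Y w x"
    unfolding sum.distrib sum_distrib_left[symmetric] 1 2 ..
  finally show ?thesis .
next
  case False
  then have "b i = 0" "w i = 0"
    using assms by (auto simp: vecs_def)
  then show ?thesis
    using False by (simp add: mulv_def)
qed

text \<open>Its Gram matrix on \<open>K\<close> is all-ones minus the identity, which is alternating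
  and has rank \<open>card K\<close> or \<open>card K - 1\<close> according to the parity of
  \<open>card K\<close>.\<close>

definition offdiag_form :: "nat set \<Rightarrow> bvec \<Rightarrow> bvec \<Rightarrow> bit" where
  "offdiag_form K y z = (\<Sum>i\<in>K. \<Sum>j\<in>K - {i}. y i * z j)"

lemma offdiag_form_add_left: "offdiag_form K (x + y) z = offdiag_form K x z + offdiag_form K y z"
  and offdiag_form_add_right: "offdiag_form K z (x + y) = offdiag_form K z x + offdiag_form K z y"
  by (simp_all add: offdiag_form_def distrib_left distrib_right sum.distrib)

definition form_radical :: "nat set \<Rightarrow> nat set \<Rightarrow> bvec set" where
  "form_radical X K = {u \<in> vecs X. \<forall>b\<in>vecs X. offdiag_form K b u = 0}"

lemma additive_radical: "additive_set (form_radical X K)"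
  by (auto simp: additive_set_def form_radical_def offdiag_form_add_right) (simp add: offdiag_form_def)

text \<open>Testing against the unit vector at \<open>k\<close> shows that \<open>u k\<close> is the
  sum of \<open>u\<close> over all of \<open>K\<close>, a value independent of
  \<open>k\<close>.\<close>

lemma radical_constant:
  assumes "finite K" "K \<subseteq> X" "u \<in> form_radical X K" "i \<in> K" "j \<in> K"
  shows "u i = u j"
proof -
  have *: "u k = (\<Sum>l\<in>K. u l)" if "k \<in> K" for k
  proof -
    have "(\<lambda>l. of_bool (l = k)) \<in> vecs X"
      using that assms by (auto simp: vecs_def)
    then have "offdiag_form K (\<lambda>l. of_bool (l = k)) u = 0"
      using assms by (simp add: form_radical_def)
    also have "offdiag_form K (\<lambda>l. of_bool (l = k)) u = (\<Sum>i\<in>K. if i = k then \<Sum>j\<in>K - {k}. u j else 0)"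
      unfolding offdiag_form_def by (intro sum.cong) auto
    also have "\<dots> = (\<Sum>j\<in>K - {k}. u j)"
      using assms that by simp
    finally show ?thesis
      using sum.remove[OF assms(1) that, of u] by simp
  qed
  show ?thesis
    using *[of i] *[of j] assms by simp
qed

text \<open>On \<open>K\<close>, a vector of the radical is zero or the all-ones vector
  \<open>h\<close>. Allowing both for either parity of \<open>card K\<close> costs at most the
  factor 2.\<close>

lemma card_radical_le:
  assumes "finite X" "K \<subseteq> X"
  shows "card (form_radical X K) * 2 ^ card K \<le> 2 * 2 ^ card X"
proof -
  have K: "finite K"
    using assms finite_subset by blast
  define h :: bvec where "h = (\<lambda>i. of_bool (i \<in> K))"
  have "form_radical X K \<subseteq> vecs (X - K) \<union> (+) h ` vecs (X - K)"
  proof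
    fix u assume u: "u \<in> form_radical X K"
    then have uX: "u \<in> vecs X"
      by (simp add: form_radical_def)
    show "u \<in> vecs (X - K) \<union> (+) h ` vecs (X - K)"
    proof (cases "\<forall>i\<in>K. u i = 0")
      case True
      then show ?thesis
        using uX by (auto simp: vecs_def)
    next
      case False
      then obtain i where "i \<in> K" "u i = 1"
        by auto
      then have "u j = 1" if "j \<in> K" for j
        using radical_constant[OF K assms(2) u, of i j] that by simp
      then have "h + u \<in> vecs (X - K)"
        using uX assms by (auto simp: vecs_def h_def)
      then show ?thesis
        by (metis UnCI bit_fun_add_left_self imageI)
    qed
  qed
  then have "card (form_radical X K) \<le> card (vecs (X - K) \<union> (+) h ` vecs (X - K))"
    using assms by (intro card_mono) auto
  also have "\<dots> \<le> card (vecs (X - K)) + card ((+) h ` vecs (X - K))"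
    by (rule card_Un_le)
  also have "card ((+) h ` vecs (X - K)) \<le> card (vecs (X - K))"
    using assms by (intro card_image_le) auto
  finally have "card (form_radical X K) \<le> 2 * 2 ^ (card X - card K)"
    using assms K by (simp add: card_vecs card_Diff_subset)
  then have "card (form_radical X K) * 2 ^ card K \<le> 2 * (2 ^ (card X - card K) * 2 ^ card K)"
    by simp
  also have "2 ^ (card X - card K) * 2 ^ card K = (2 ^ card X :: nat)"
    using assms by (simp add: card_mono flip: power_add)
  finally show ?thesis .
qed

text \<open>Testing pairs in list order suffices, as the form is symmetric and vanishes on equal
  arguments.\<close>

fun isotropic :: "nat set \<Rightarrow> bvec list \<Rightarrow> bool" where
  "isotropic K [] \<longleftrightarrow> True"
| "isotropic K (z # zs) \<longleftrightarrow> isotropic K zs \<and> (\<forall>y\<in>set zs. offdiag_form K z y = 0)"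

text \<open>
  \<open>red A\<close> is the matrix whose kernel is studied and \<open>A\<close> the data parametrizing it.  The columns of
  \<open>red A\<close> outside \<open>Y\<close> are rigid and its rows outside \<open>Y\<close> are not tied to any column: \<open>Y = X\<close> for the first
  two Pell rules, while the third one misses a single index.
\<close>

locale bit_family =
  fixes X Y K :: "nat set" and \<A> :: "(nat \<Rightarrow> nat \<Rightarrow> bit) set"
    and red :: "(nat \<Rightarrow> nat \<Rightarrow> bit) \<Rightarrow> nat \<Rightarrow> nat \<Rightarrow> bit"
  assumes finite_X: "finite X" and Y_subset: "Y \<subseteq> X" and K_subset: "K \<subseteq> X"
    and finite_family: "finite \<A>" and nonempty: "\<A> \<noteq> {}"
    and shift_in: "A \<in> \<A> \<Longrightarrow> b \<in> vecs X \<Longrightarrow> w \<in> vecs Y \<Longrightarrow> A + symm Y b w c \<in> \<A>"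
    and red_shift: "A \<in> \<A> \<Longrightarrow> b \<in> vecs X \<Longrightarrow> w \<in> vecs Y \<Longrightarrow> i \<in> X \<Longrightarrow> j \<in> X \<Longrightarrow>
      red (A + symm Y b w c) i j = red A i j + symm Y b w c i j"
    and form: "A \<in> \<A> \<Longrightarrow> y \<in> vecs X \<Longrightarrow> z \<in> vecs X \<Longrightarrow>
      dotp Y y (mulv X (red A) z) + dotp Y z (mulv X (red A) y) = offdiag_form K y z"
    and regular: "A \<in> \<A> \<Longrightarrow> r \<in> vecs (X - Y) \<Longrightarrow> mulv X (red A) r = 0 \<Longrightarrow> r = 0"
begin

abbreviation act :: "(nat \<Rightarrow> nat \<Rightarrow> bit) \<Rightarrow> bvec \<Rightarrow> bvec" where
  "act A \<equiv> mulv X (red A)"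

lemma finite_Y: "finite Y"
  using finite_subset[OF Y_subset finite_X] .

lemma act_shift:
  assumes "A \<in> \<A>" "b \<in> vecs X" "w \<in> vecs Y"
  shows "act (A + symm Y b w c) x = act A x + mulv X (symm Y b w c) x"
proof -
  have "act (A + symm Y b w c) x = mulv X (red A + symm Y b w c) x"
    using red_shift[OF assms] by (intro mulv_cong) auto
  then show ?thesis
    by (simp add: mulv_add_left)
qed

section \<open>Matrices annihilating a given tuple\<close>

definition sol :: "bvec list \<Rightarrow> (nat \<Rightarrow> nat \<Rightarrow> bit) set" where
  "sol zs = {A \<in> \<A>. \<forall>z\<in>set zs. act A z = 0}"

lemma finite_sol [simp]: "finite (sol zs)"
  by (simp add: sol_def finite_family)

text \<open>This is the range of \<open>act A z\<close> for \<open>A\<close> annihilating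
  \<open>zs\<close>, once \<open>z\<close> is orthogonal to \<open>zs\<close> under the
  form.\<close>

definition perp :: "bvec list \<Rightarrow> bvec set" where
  "perp zs = {b \<in> vecs X. \<forall>z\<in>set zs. dotp Y b z = 0}"

abbreviation off :: "bvec set" where
  "off \<equiv> vecs (X - Y)"

text \<open>A vector of the span that pairs to 0 with all of \<open>vecs Z\<close> vanishes on
  \<open>Y\<close>, so it lies in \<open>off\<close> and is zero by independence; double counting
  then gives the size. \<open>Z\<close> is \<open>X\<close> for \<open>perp\<close> and
  \<open>Y\<close> for dual vectors.\<close>

lemma card_perp_gen:
  assumes "indep off zs" "set zs \<subseteq> vecs X" "Y \<subseteq> Z" "Z \<subseteq> X"
  shows "card {b \<in> vecs Z. \<forall>z\<in>set zs. dotp Y b z = 0} * 2 ^ length zs = 2 ^ card Z"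
proof -
  have fZ: "finite Z"
    using finite_subset[OF assms(4) finite_X] .
  have "{u \<in> spn zs. \<forall>b\<in>vecs Z. dotp Y b u = 0} = {0}"
  proof safe
    fix u assume u: "u \<in> spn zs" "\<forall>b\<in>vecs Z. dotp Y b u = 0"
    have "u i = 0" if "i \<in> Y" for i
    proof (rule dotp_eq_0_imp[OF finite_Y _ that])
      show "dotp Y b u = 0" if "b \<in> vecs Y" for b
        using u that vecs_mono[OF assms(3)] by blast
    qed
    moreover have "u \<in> vecs X"
      using u spn_subset[OF additive_vecs assms(2)] by auto
    ultimately have "u \<in> off"
      by (auto simp: vecs_def)
    then show "u = 0"
      using indep_spn_inter[OF assms(1) additive_vecs u(1)] by blast
  qed (auto simp: dotp_def)
  then have "card {u \<in> spn zs. \<forall>b\<in>vecs Z. dotp Y b u = 0} = 1"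
    by simp
  moreover have "(\<forall>u\<in>spn zs. dotp Y b u = 0) \<longleftrightarrow> (\<forall>z\<in>set zs. dotp Y b z = 0)" for b
    by (rule additive_vanish_spn) (rule dotp_add_right)
  ultimately show ?thesis
    using card_annihilator[where \<beta> = "dotp Y", OF finite_spn additive_spn finite_vecs[OF fZ] additive_vecs
        dotp_add_left dotp_add_right, of zs] card_spn[OF assms(1)] fZ
    by (simp add: card_vecs)
qed

lemma card_perp:
  assumes "indep off zs" "set zs \<subseteq> vecs X"
  shows "card (perp zs) * 2 ^ length zs = 2 ^ card X"
  unfolding perp_def using assms Y_subset by (rule card_perp_gen) simp

text \<open>Adding \<open>z\<close> to the tuple halves the set of annihilating vectors, so one of
  those for \<open>zs\<close> does not kill \<open>z\<close>.\<close>

lemma ex_dual: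
  assumes "indep off (z # zs)" "set (z # zs) \<subseteq> vecs X"
  obtains w where "w \<in> vecs Y" "\<And>y. y \<in> set zs \<Longrightarrow> dotp Y w y = 0" "dotp Y w z = 1"
proof -
  let ?P = "\<lambda>zs. {b \<in> vecs Y. \<forall>z\<in>set zs. dotp Y b z = 0}"
  have e1: "card (?P zs) * 2 ^ length zs = 2 ^ card Y"
    using assms Y_subset by (intro card_perp_gen[OF _ _ order_refl]) auto
  have e2: "card (?P (z # zs)) * 2 ^ length (z # zs) = 2 ^ card Y"
    by (rule card_perp_gen[OF assms order_refl Y_subset])
  have "card (?P zs) \<noteq> card (?P (z # zs))"
  proof
    assume "card (?P zs) = card (?P (z # zs))"
    then have "2 * 2 ^ card Y = (2 ^ card Y :: nat)"
      using e1 e2 by (simp only: length_Cons power_Suc mult.left_commute)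
    then show False
      by simp
  qed
  then have "?P zs \<noteq> ?P (z # zs)"
    by (rule contrapos_nn) (rule arg_cong)
  moreover have "?P zs = ?P (z # zs)" if "\<forall>w\<in>?P zs. dotp Y w z = 0"
    using that by auto
  ultimately obtain w where "w \<in> ?P zs" "dotp Y w z \<noteq> 0"
    by blast
  then show ?thesis
    using that[of w] by simp
qed

text \<open>A matrix annihilating \<open>zs\<close> corresponds to one that also annihilates \<open>z\<close>, together with the vector to which
  the former maps \<open>z\<close>.\<close>

lemma card_sol_step:
  assumes ind: "indep off (z # zs)" and iso: "isotropic K (z # zs)" and sub: "set (z # zs) \<subseteq> vecs X"
  shows "card (sol zs) * 2 ^ length zs = card (sol (z # zs)) * 2 ^ card X"
proof -
  obtain w where w: "w \<in> vecs Y" "\<And>y. y \<in> set zs \<Longrightarrow> dotp Y w y = 0" "dotp Y w z = 1"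
    using ex_dual[OF ind sub] by blast
  \<comment> \<open>The last coefficient is chosen to cancel the unwanted term
    \<open>w i * dotp Y b z\<close> in the image of \<open>z\<close>.\<close>
  define S where "S b = symm Y b w (dotp Y b z)" for b
  have S_old: "mulv X (S b) y = 0" if "b \<in> perp zs" "y \<in> set zs" for b y
    using that w unfolding S_def
    by (auto simp: fun_eq_iff mulv_symm[OF finite_X Y_subset w(1)] perp_def)
  have S_new: "mulv X (S b) z = b" if "b \<in> perp zs" for b
  proof
    fix i
    have "b \<in> vecs X"
      using that by (simp add: perp_def)
    then have "mulv X (S b) z i = b i + w i * dotp Y b z + dotp Y b z * w i"
      unfolding S_def by (simp add: mulv_symm[OF finite_X Y_subset w(1)] w(3))
    then show "mulv X (S b) z i = b i"
      by (simp add: add.assoc mult.commute[of "w i"])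
  qed
  have act_S: "act (A + S b) x = act A x + mulv X (S b) x" "A + S b \<in> \<A>" if "A \<in> \<A>" "b \<in> perp zs" for A b x
    using that(2) act_shift[OF that(1) _ w(1)] shift_in[OF that(1) _ w(1)] by (simp_all add: S_def perp_def)
  have SS: "A + S b + S b = A" for A b
    by (rule ext, rule ext) (simp only: plus_fun_apply add.assoc bit_add_self add_0_right)
  \<comment> \<open>The form is the alternating part of \<open>act A\<close>, and
    \<open>act A y = 0\<close>; so isotropy of \<open>z\<close> and \<open>y\<close> says that the
    image of \<open>z\<close> is orthogonal to \<open>y\<close>.\<close>
  have az: "act A z \<in> perp zs" if "A \<in> sol zs" for A
  proof -
    have "dotp Y (act A z) y = 0" if "y \<in> set zs" for y
    proof -
      have "dotp Y z (act A y) + dotp Y y (act A z) = 0"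
        using that \<open>A \<in> sol zs\<close> iso sub by (subst form) (auto simp: sol_def)
      moreover have "act A y = 0"
        using that \<open>A \<in> sol zs\<close> by (simp add: sol_def)
      ultimately show ?thesis
        by (simp add: dotp_commute) (simp add: dotp_def)
    qed
    then show ?thesis
      by (simp add: perp_def)
  qed
  have "bij_betw (\<lambda>A. (A + S (act A z), act A z)) (sol zs) (sol (z # zs) \<times> perp zs)"
  proof (rule bij_betw_byWitness[where f' = "\<lambda>(A, b). A + S b"])
    show "\<forall>A\<in>sol zs. (case (A + S (act A z), act A z) of (A, b) \<Rightarrow> A + S b) = A"
      by (simp add: SS)
    show "\<forall>p\<in>sol (z # zs) \<times> perp zs.
      ((case p of (A, b) \<Rightarrow> A + S b) + S (act (case p of (A, b) \<Rightarrow> A + S b) z),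
        act (case p of (A, b) \<Rightarrow> A + S b) z) = p"
    proof
      fix p assume "p \<in> sol (z # zs) \<times> perp zs"
      then obtain A b where p: "p = (A, b)" "A \<in> sol (z # zs)" "b \<in> perp zs"
        by auto
      then have "act (A + S b) z = b"
        by (simp add: sol_def act_S S_new)
      then show "((case p of (A, b) \<Rightarrow> A + S b) + S (act (case p of (A, b) \<Rightarrow> A + S b) z),
        act (case p of (A, b) \<Rightarrow> A + S b) z) = p"
        by (simp add: SS p(1))
    qed
    show "(\<lambda>A. (A + S (act A z), act A z)) ` sol zs \<subseteq> sol (z # zs) \<times> perp zs"
    proof safe
      fix A assume A: "A \<in> sol zs"
      then have "A \<in> \<A>"
        by (simp add: sol_def)
      with A show "A + S (act A z) \<in> sol (z # zs)"
        using az[OF A] by (auto simp: sol_def act_S S_new S_old)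
    qed (rule az)
    show "(\<lambda>(A, b). A + S b) ` (sol (z # zs) \<times> perp zs) \<subseteq> sol zs"
      by (auto simp: sol_def act_S S_old)
  qed
  then have "card (sol zs) = card (sol (z # zs)) * card (perp zs)"
    by (simp add: bij_betw_same_card card_cartesian_product)
  then show ?thesis
    using card_perp[of zs] ind sub by simp
qed

end

section \<open>Moments of the number of injections into the kernel\<close>

lemma indep_mono: "indep R zs \<Longrightarrow> R' \<subseteq> R \<Longrightarrow> indep R' zs"
  by (induction zs) auto

lemma two_power_eq_sqrt: "(2::real) ^ n = sqrt 2 ^ (2 * n)"
  by (simp add: power_mult)

lemma card_klists_Suc_real:
  assumes "finite V"
  shows "real (card {zs \<in> klists (Suc k) V. P zs}) = (\<Sum>zs\<in>klists k V. real (card {z \<in> V. P (z # zs)}))"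
  using card_klists_Suc[OF assms] by simp

lemma card_filter_real:
  "finite V \<Longrightarrow> real (card {x \<in> V. P x}) = (\<Sum>x\<in>V. of_bool (P x))"
  by (simp add: Int_def)

context bit_family
begin

abbreviation N :: nat where "N \<equiv> card X"

lemma card_V: "real (card (vecs X)) = 2 ^ N"
  by (simp add: card_vecs finite_X)

text \<open>Given that \<open>zs\<close> is annihilated, the image of \<open>z\<close> is uniform on
  \<open>perp zs\<close>, which has \<open>2 ^ N / 2 ^ length zs\<close> elements. The lengths 0, 1,
  2, ... met on the way add up to \<open>tri_num\<close>.\<close>

lemma card_sol:
  assumes "indep off zs" "isotropic K zs" "set zs \<subseteq> vecs X"
  shows "card (sol zs) * 2 ^ (N * length zs) = card \<A> * 2 ^ tri_num (length zs)"
  using assms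
proof (induction zs)
  case Nil
  show ?case
    by (simp add: sol_def)
next
  case (Cons z zs)
  have "card (sol (z # zs)) * 2 ^ (N * length (z # zs)) = card (sol (z # zs)) * 2 ^ N * 2 ^ (N * length zs)"
    by (simp add: power_add)
  also have "\<dots> = card (sol zs) * 2 ^ length zs * 2 ^ (N * length zs)"
    by (simp only: card_sol_step[OF Cons.prems])
  also have "\<dots> = card (sol zs) * 2 ^ (N * length zs) * 2 ^ length zs"
    by (simp only: mult_ac)
  also have "card (sol zs) * 2 ^ (N * length zs) = card \<A> * 2 ^ tri_num (length zs)"
    using Cons by simp
  finally show ?case
    by (simp add: power_add mult.assoc)
qed

lemma sol_isotropic:
  assumes "A \<in> sol zs" "set zs \<subseteq> vecs X"
  shows "isotropic K zs"
  using assms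
proof (induction zs)
  case (Cons z zs)
  have "offdiag_form K z y = 0" if "y \<in> set zs" for y
  proof -
    have "A \<in> \<A>" "act A y = 0" "act A z = 0" "y \<in> vecs X" "z \<in> vecs X"
      using Cons.prems that by (auto simp: sol_def)
    then show ?thesis
      using form[of A z y] by (simp add: dotp_def)
  qed
  moreover have "A \<in> sol zs"
    using Cons.prems by (simp add: sol_def)
  ultimately show ?case
    using Cons by simp
qed simp

text \<open>A combination lying in \<open>off\<close> would itself be in the kernel, and
  \<open>regular\<close> allows no nonzero kernel vector there.\<close>

lemma sol_indep:
  assumes "A \<in> sol zs" "indep {0} zs" "set zs \<subseteq> vecs X"
  shows "indep off zs"
  using assms
proof (induction zs)
  case (Cons z zs)
  have "z + u \<notin> off" if u: "u \<in> spn zs" for u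
  proof
    assume off: "z + u \<in> off"
    have A: "A \<in> \<A>" and "set zs \<subseteq> kern X (red A)" "act A z = 0"
      using Cons.prems by (auto simp: sol_def kern_def)
    then have "u \<in> kern X (red A)"
      using spn_subset[OF additive_kern] u by blast
    then have "act A (z + u) = 0"
      using \<open>act A z = 0\<close> by (simp add: kern_def mulv_add_right)
    then have "z + u = 0"
      using regular[OF A off] by blast
    then show False
      using Cons.prems u by simp
  qed
  moreover have "A \<in> sol zs"
    using Cons.prems by (simp add: sol_def)
  ultimately show ?case
    using Cons by simp
qed simp

text \<open>The moment is exactly the normalized \<open>good_count\<close>. It is dominated by
  \<open>iso_count\<close>, which has a clean recursion except at the tuples counted by
  \<open>bad_count\<close>.\<close>

definition iso_count :: "nat \<Rightarrow> nat" where
  "iso_count k = card {zs \<in> klists k (vecs X). isotropic K zs}"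

definition good_count :: "nat \<Rightarrow> nat" where
  "good_count k = card {zs \<in> klists k (vecs X). isotropic K zs \<and> indep off zs}"

definition bad_count :: "nat \<Rightarrow> nat" where
  "bad_count k = card {zs \<in> klists k (vecs X). \<not> indep (form_radical X K) zs}"

text \<open>The factor is the probability that a given independent isotropic \<open>k\<close>-tuple lies in the kernel.\<close>

definition normalize :: "nat \<Rightarrow> nat \<Rightarrow> real" where
  "normalize k c = 2 ^ tri_num k / 2 ^ (N * k) * real c"

lemma finite_klists_V [simp]: "finite (klists k (vecs X))"
  by (simp add: finite_X)

text \<open>Pairs of a matrix and an independent tuple in its kernel are counted by tuples: only
  isotropic ones independent modulo \<open>off\<close> occur, all with the frequency from
  \<open>card_sol\<close>.\<close>

lemma sum_inj_count:
  assumes d: "\<And>A. A \<in> \<A> \<Longrightarrow> card (kern X (red A)) = 2 ^ d A"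
  shows "(\<Sum>A\<in>\<A>. inj_count k (d A)) / real (card \<A>) = normalize k (good_count k)"
proof -
  have kern_V: "kern X (red A) \<subseteq> vecs X" for A
    by (auto simp: kern_def)
  have "(\<Sum>A\<in>\<A>. inj_count k (d A)) = (\<Sum>A\<in>\<A>. real (card {zs \<in> klists k (kern X (red A)). indep {0} zs}))"
  proof (rule sum.cong)
    fix A assume "A \<in> \<A>"
    have "finite (kern X (red A))"
      using finite_subset[OF kern_V] finite_X by simp
    then show "inj_count k (d A) = real (card {zs \<in> klists k (kern X (red A)). indep {0} zs})"
      using card_indep_klists[OF _ additive_kern d[OF \<open>A \<in> \<A>\<close>]] by simp
  qed simp
  also have "\<dots> = (\<Sum>A\<in>\<A>. \<Sum>zs\<in>klists k (vecs X). of_bool (indep {0} zs \<and> A \<in> sol zs))"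
  proof (rule sum.cong)
    fix A assume "A \<in> \<A>"
    then have "{zs \<in> klists k (kern X (red A)). indep {0} zs}
      = {zs \<in> klists k (vecs X). indep {0} zs \<and> A \<in> sol zs}"
      by (auto simp: klists_def sol_def kern_def)
    then show "real (card {zs \<in> klists k (kern X (red A)). indep {0} zs})
      = (\<Sum>zs\<in>klists k (vecs X). of_bool (indep {0} zs \<and> A \<in> sol zs))"
      by (simp only: card_filter_real finite_klists_V)
  qed simp
  also have "\<dots> = (\<Sum>zs\<in>klists k (vecs X). \<Sum>A\<in>\<A>. of_bool (indep {0} zs \<and> A \<in> sol zs))"
    by (rule sum.swap)
  also have "\<dots> = (\<Sum>zs\<in>klists k (vecs X). of_bool (isotropic K zs \<and> indep off zs) *
      (real (card \<A>) * 2 ^ tri_num k / 2 ^ (N * k)))"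
  proof (rule sum.cong)
    fix zs assume "zs \<in> klists k (vecs X)"
    then have zs: "set zs \<subseteq> vecs X" "length zs = k"
      by (auto simp: klists_def)
    have "(\<Sum>A\<in>\<A>. of_bool (indep {0} zs \<and> A \<in> sol zs)) = (of_bool (indep {0} zs) * real (card (sol zs)) :: real)"
      unfolding of_bool_conj sum_distrib_left[symmetric]
      by (simp add: sol_def card_filter_real finite_family)
    also have "\<dots> = of_bool (isotropic K zs \<and> indep off zs) *
      (real (card \<A>) * 2 ^ tri_num k / 2 ^ (N * k))"
    proof (cases "isotropic K zs \<and> indep off zs")
      case True
      then have "real (card (sol zs) * 2 ^ (N * k)) = real (card \<A> * 2 ^ tri_num k)"
        using card_sol[of zs] zs by simp
      then have "real (card (sol zs)) = real (card \<A>) * 2 ^ tri_num k / 2 ^ (N * k)"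
        by (simp add: field_simps)
      moreover have "indep {0} zs"
        using True indep_mono[of off zs "{0}"] by simp
      ultimately show ?thesis
        using True by simp
    next
      case False
      then have "indep {0} zs \<Longrightarrow> sol zs = {}"
        using sol_isotropic[OF _ zs(1)] sol_indep[OF _ _ zs(1)] by blast
      then show ?thesis
        using False by auto
    qed
    finally show "(\<Sum>A\<in>\<A>. of_bool (indep {0} zs \<and> A \<in> sol zs)) = of_bool (isotropic K zs \<and> indep off zs) *
      (real (card \<A>) * 2 ^ tri_num k / 2 ^ (N * k))" .
  qed simp
  also have "\<dots> = real (good_count k) * (real (card \<A>) * 2 ^ tri_num k / 2 ^ (N * k))"
    unfolding good_count_def card_filter_real[OF finite_klists_V] sum_distrib_right ..
  finally show ?thesis
    using nonempty finite_family by (simp add: normalize_def)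
qed

lemma annihilator_form:
  assumes "set zs \<subseteq> vecs X"
  shows "card {z \<in> vecs X. \<forall>y\<in>set zs. offdiag_form K z y = 0} * card (spn zs)
       = 2 ^ N * card (spn zs \<inter> form_radical X K)"
proof -
  have "(\<forall>u\<in>spn zs. offdiag_form K b u = 0) \<longleftrightarrow> (\<forall>y\<in>set zs. offdiag_form K b y = 0)" for b
    by (rule additive_vanish_spn) (rule offdiag_form_add_right)
  moreover have "{u \<in> spn zs. \<forall>b\<in>vecs X. offdiag_form K b u = 0} = spn zs \<inter> form_radical X K"
    using spn_subset[OF additive_vecs assms] by (auto simp: form_radical_def)
  ultimately show ?thesis
    using card_annihilator[where \<beta> = "offdiag_form K", OF finite_spn additive_spn
        finite_vecs[OF finite_X] additive_vecs offdiag_form_add_left offdiag_form_add_right, of zs]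
    by (simp add: card_vecs finite_X)
qed

lemma zero_in_radical: "0 \<in> form_radical X K"
  using additive_radical by (simp add: additive_set_def)

lemma annihilator_ge:
  assumes "zs \<in> klists k (vecs X)"
  shows "real (card {z \<in> vecs X. \<forall>y\<in>set zs. offdiag_form K z y = 0}) \<ge> 2 ^ N / 2 ^ k"
proof -
  have zs: "set zs \<subseteq> vecs X" "length zs = k"
    using assms by (auto simp: klists_def)
  let ?c = "card {z \<in> vecs X. \<forall>y\<in>set zs. offdiag_form K z y = 0}"
  have "0 \<in> spn zs \<inter> form_radical X K"
    using zero_in_radical by simp
  then have "card (spn zs \<inter> form_radical X K) > 0"
    by (metis card_gt_0_iff emptyE finite_Int finite_spn)
  then have "2 ^ N * 1 \<le> (2 ^ N * card (spn zs \<inter> form_radical X K) :: nat)"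
    by (intro mult_left_mono) auto
  also have "\<dots> = ?c * card (spn zs)"
    using annihilator_form[OF zs(1)] by simp
  also have "\<dots> \<le> ?c * 2 ^ k"
    using card_spn_le[of zs] zs by (intro mult_left_mono) auto
  finally have "real (2 ^ N) \<le> real (?c * 2 ^ k)"
    by (simp only: of_nat_le_iff mult_1_right)
  then show ?thesis
    by (simp add: field_simps)
qed

lemma annihilator_eq:
  assumes "zs \<in> klists k (vecs X)" "indep (form_radical X K) zs"
  shows "real (card {z \<in> vecs X. \<forall>y\<in>set zs. offdiag_form K z y = 0}) = 2 ^ N / 2 ^ k"
proof -
  have zs: "set zs \<subseteq> vecs X" "length zs = k"
    using assms by (auto simp: klists_def)
  let ?c = "card {z \<in> vecs X. \<forall>y\<in>set zs. offdiag_form K z y = 0}"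
  have "spn zs \<inter> form_radical X K = {0}"
    using indep_spn_inter[OF assms(2) additive_radical] zero_in_radical by auto
  then have "?c * 2 ^ k = 2 ^ N"
    using annihilator_form[OF zs(1)] card_spn[OF assms(2) zero_in_radical] zs by simp
  then have "real (?c * 2 ^ k) = real (2 ^ N)"
    by (simp only:)
  then show ?thesis
    by (simp add: field_simps)
qed

text \<open>At least \<open>2 ^ N / 2 ^ k\<close> vectors keep the tuple isotropic, whatever its
  position relative to the radical. At most \<open>2 ^ k\<close> translates of \<open>off\<close>
  are lost to dependence.\<close>

lemma good_count_Suc_ge:
  "real (good_count (Suc k)) \<ge> real (good_count k) * (2 ^ N / 2 ^ k - 2 ^ k * 2 ^ card (X - Y))"
proof -
  have step: "real (card {z \<in> vecs X. isotropic K (z # zs) \<and> indep off (z # zs)})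
      \<ge> of_bool (isotropic K zs \<and> indep off zs) * (2 ^ N / 2 ^ k - 2 ^ k * 2 ^ card (X - Y))"
    if zs: "zs \<in> klists k (vecs X)" for zs
  proof (cases "isotropic K zs \<and> indep off zs")
    case True
    let ?P = "{z \<in> vecs X. \<forall>y\<in>set zs. offdiag_form K z y = 0}"
    let ?D = "{z \<in> vecs X. \<exists>u\<in>spn zs. z + u \<in> off}"
    let ?G = "{z \<in> vecs X. isotropic K (z # zs) \<and> indep off (z # zs)}"
    have "?P \<subseteq> ?G \<union> ?D"
      using True by auto
    then have "card ?P \<le> card (?G \<union> ?D)"
      using finite_X by (intro card_mono) auto
    also have "\<dots> \<le> card ?G + card ?D"
      by (rule card_Un_le)
    also have "card ?D \<le> 2 ^ k * 2 ^ card (X - Y)"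
      using card_dependent_le[of off "vecs X" zs] zs finite_X by (simp add: klists_def card_vecs)
    finally have "real (card ?P) \<le> real (card ?G + 2 ^ k * 2 ^ card (X - Y))"
      by (simp only: of_nat_le_iff add_left_mono)
    then show ?thesis
      using annihilator_ge[OF zs] True by simp
  next
    case False
    then show ?thesis
      by (auto simp: of_bool_def)
  qed
  have "real (good_count k) * (2 ^ N / 2 ^ k - 2 ^ k * 2 ^ card (X - Y))
      = (\<Sum>zs\<in>klists k (vecs X). of_bool (isotropic K zs \<and> indep off zs) * (2 ^ N / 2 ^ k - 2 ^ k * 2 ^ card (X - Y)))"
    unfolding good_count_def card_filter_real[OF finite_klists_V] sum_distrib_right ..
  also have "\<dots> \<le> real (good_count (Suc k))"
    unfolding good_count_def card_klists_Suc_real[OF finite_vecs[OF finite_X]]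
    by (intro sum_mono step)
  finally show ?thesis .
qed

lemma normalize_Suc: "normalize (Suc k) c = 2 ^ tri_num k / 2 ^ (N * k) * (2 ^ k / 2 ^ N * real c)"
  by (simp add: normalize_def power_add mult_ac)

lemma good_count_0: "good_count 0 = 1" and iso_count_0: "iso_count 0 = 1"
proof -
  have "{zs. zs = ([] :: bvec list) \<and> isotropic K zs \<and> indep off zs} = {[]}"
    "{zs. zs = ([] :: bvec list) \<and> isotropic K zs} = {[]}"
    by auto
  then show "good_count 0 = 1" "iso_count 0 = 1"
    by (simp_all add: good_count_def iso_count_def)
qed

lemma normalize_good_ge: "normalize k (good_count k) \<ge> 1 - 4 ^ k * (2 ^ card (X - Y) / 2 ^ N)"
proof (induction k)
  case 0
  then show ?case
    by (simp add: normalize_def good_count_0)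
next
  case (Suc k)
  define \<delta> m :: real where "\<delta> = 2 ^ card (X - Y) / 2 ^ N" and "m = normalize k (good_count k)"
  have pos: "0 \<le> m" "0 \<le> \<delta>" "0 \<le> normalize (Suc k) (good_count (Suc k))"
    by (simp_all add: m_def \<delta>_def normalize_def)
  have "m * (1 - 4 ^ k * \<delta>)
      = 2 ^ tri_num k / 2 ^ (N * k) * (2 ^ k / 2 ^ N * (real (good_count k) * (2 ^ N / 2 ^ k - 2 ^ k * 2 ^ card (X - Y))))"
  proof -
    have "a / b * (b / a - a * c) = 1 - a * a * (c / b)" if "a > 0" "b > 0" for a b c :: real
      using that by (simp add: field_simps)
    moreover have "(4::real) ^ k = 2 ^ k * 2 ^ k"
      by (simp flip: power_mult_distrib)
    ultimately have eq: "2 ^ k / 2 ^ N * (2 ^ N / 2 ^ k - 2 ^ k * 2 ^ card (X - Y)) = 1 - 4 ^ k * \<delta>"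
      by (simp add: \<delta>_def)
    show ?thesis
      unfolding mult.left_commute[of "2 ^ k / 2 ^ N"] eq m_def normalize_def by (rule mult.assoc)
  qed
  also have "\<dots> \<le> normalize (Suc k) (good_count (Suc k))"
    unfolding normalize_Suc by (intro mult_left_mono good_count_Suc_ge) auto
  finally have le: "m * (1 - 4 ^ k * \<delta>) \<le> normalize (Suc k) (good_count (Suc k))" .
  show ?case
  \<comment> \<open>Multiplying the induction hypothesis requires a nonnegative factor 1 - x; then
    (1 - x)^2 \<ge> 1 - 2x \<ge> 1 - 4x. Otherwise the claimed lower bound is negative.\<close>
  proof (cases "4 ^ k * \<delta> \<le> 1")
    case True
    have "(1 - 4 ^ k * \<delta>) * (1 - 4 ^ k * \<delta>) \<le> m * (1 - 4 ^ k * \<delta>)"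
      using Suc True by (intro mult_right_mono) (auto simp: m_def \<delta>_def)
    moreover have "1 - 2 * (4 ^ k * \<delta>) \<le> (1 - 4 ^ k * \<delta>) * (1 - 4 ^ k * \<delta>)"
      using zero_le_square[of "4 ^ k * \<delta>"] by (simp only: left_diff_distrib right_diff_distrib)
    moreover have "1 - 4 ^ Suc k * \<delta> \<le> 1 - 2 * (4 ^ k * \<delta>)"
      using pos by simp
    ultimately show ?thesis
      using le unfolding \<delta>_def by linarith
  next
    case False
    moreover have "4 ^ k * \<delta> \<le> 4 ^ Suc k * \<delta>"
      using pos by (intro mult_right_mono) auto
    ultimately show ?thesis
      using pos unfolding \<delta>_def by linarith
  qed
qed

lemma bad_count_le: "real (bad_count k) / 2 ^ (N * k) \<le> 1"
proof -
  have "bad_count k \<le> card (klists k (vecs X))"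
    unfolding bad_count_def by (intro card_mono) auto
  also have "\<dots> = 2 ^ (N * k)"
    by (simp add: card_klists finite_X card_vecs power_mult)
  finally have "real (bad_count k) \<le> real (2 ^ (N * k))"
    by (simp only: of_nat_le_iff)
  then show ?thesis
    by simp
qed

text \<open>Union bound over the entry that breaks independence: after \<open>i\<close> entries it
  lies in one of at most \<open>2 ^ i\<close> translates of the radical, and these powers for i < k
  sum to less than \<open>2 ^ k\<close>.\<close>

lemma bad_count_le_radical: "bad_count k * 2 ^ N \<le> 2 ^ k * card (form_radical X K) * 2 ^ (N * k)"
proof (induction k)
  case 0
  have "{zs \<in> klists 0 (vecs X). \<not> indep (form_radical X K) zs} = {}"
    by auto
  then show ?case
    unfolding bad_count_def by (simp only: card.empty)
next
  case (Suc k)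
  define \<rho> where "\<rho> = card (form_radical X K)"
  have fr: "finite (form_radical X K)"
    by (simp add: form_radical_def finite_X)
  have step: "card {z \<in> vecs X. \<not> indep (form_radical X K) (z # zs)}
      \<le> of_bool (\<not> indep (form_radical X K) zs) * 2 ^ N + 2 ^ k * \<rho>"
    if zs: "zs \<in> klists k (vecs X)" for zs
  proof (cases "indep (form_radical X K) zs")
    case True
    have len: "length zs = k"
      using zs by (simp add: klists_def)
    have "{z \<in> vecs X. \<not> indep (form_radical X K) (z # zs)} = {z \<in> vecs X. \<exists>u\<in>spn zs. z + u \<in> form_radical X K}"
      using True by auto
    then show ?thesis
      using True card_dependent_le[OF fr finite_vecs[OF finite_X], of zs] by (simp add: len \<rho>_def)
  next
    case False
    have "card {z \<in> vecs X. \<not> indep (form_radical X K) (z # zs)} \<le> card (vecs X)"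
      using finite_X by (intro card_mono) auto
    then show ?thesis
      using False by (simp add: card_vecs finite_X)
  qed
  have "bad_count (Suc k) \<le> (\<Sum>zs\<in>klists k (vecs X). of_bool (\<not> indep (form_radical X K) zs) * 2 ^ N + 2 ^ k * \<rho>)"
    unfolding bad_count_def card_klists_Suc[OF finite_vecs[OF finite_X]]
    by (intro sum_mono step)
  also have "\<dots> = bad_count k * 2 ^ N + 2 ^ (N * k) * (2 ^ k * \<rho>)"
    by (simp add: sum.distrib bad_count_def card_klists finite_X card_vecs power_mult Int_def flip: sum_distrib_right)
  also have "\<dots> \<le> 2 ^ k * \<rho> * 2 ^ (N * k) + 2 ^ (N * k) * (2 ^ k * \<rho>)"
    using Suc unfolding \<rho>_def by (intro add_right_mono)
  also have "\<dots> = 2 ^ Suc k * \<rho> * 2 ^ (N * k)"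
    by simp
  finally have "bad_count (Suc k) * 2 ^ N \<le> 2 ^ Suc k * \<rho> * 2 ^ (N * k) * 2 ^ N"
    by (rule mult_right_mono) simp
  then show ?case
    by (simp add: \<rho>_def power_add mult_ac)
qed

text \<open>Geometric mean of the two previous bounds: either one alone is too weak, the first for small \<open>k\<close> and
  the second for large \<open>k\<close>.\<close>

lemma bad_count_le_sqrt:
  "real (bad_count k) / 2 ^ (N * k) \<le> sqrt 2 ^ k * (sqrt 2 * (1 / sqrt 2) ^ card K)"
proof -
  define b where "b = real (bad_count k) / 2 ^ (N * k)"
  have b: "0 \<le> b" "b \<le> 1"
    using bad_count_le by (auto simp: b_def)
  have "bad_count k * 2 ^ N * 2 ^ card K \<le> 2 ^ k * card (form_radical X K) * 2 ^ (N * k) * 2 ^ card K"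
    by (intro mult_right_mono bad_count_le_radical) auto
  also have "\<dots> = 2 ^ k * 2 ^ (N * k) * (card (form_radical X K) * 2 ^ card K)"
    by (simp only: mult_ac)
  also have "\<dots> \<le> 2 ^ k * 2 ^ (N * k) * (2 * 2 ^ N)"
    by (intro mult_left_mono card_radical_le finite_X K_subset) auto
  finally have "(bad_count k * 2 ^ card K) * 2 ^ N \<le> (2 ^ k * 2 ^ (N * k) * 2) * 2 ^ N"
    by (simp only: mult_ac)
  then have "bad_count k * 2 ^ card K \<le> 2 ^ k * 2 ^ (N * k) * 2"
    by simp
  then have "real (bad_count k * 2 ^ card K) \<le> real (2 ^ k * 2 ^ (N * k) * 2)"
    by (simp only: of_nat_le_iff)
  then have "b \<le> 2 ^ k * (2 / 2 ^ card K)"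
    by (simp add: b_def field_simps)
  moreover have "b\<^sup>2 \<le> b"
    using b by (simp add: power2_eq_square mult_left_le)
  moreover have "(sqrt 2 ^ k * (sqrt 2 * (1 / sqrt 2) ^ card K))\<^sup>2 = 2 ^ k * (2 / 2 ^ card K)"
    by (simp add: power_mult_distrib power_divide flip: power_mult) (simp add: power_mult mult.commute[of _ 2])
  ultimately have "b\<^sup>2 \<le> (sqrt 2 ^ k * (sqrt 2 * (1 / sqrt 2) ^ card K))\<^sup>2"
    by linarith
  then show ?thesis
    unfolding b_def[symmetric] by (rule power2_le_imp_le) simp
qed

text \<open>Isotropic tuples independent modulo the radical have exactly
  \<open>2 ^ N / 2 ^ k\<close> isotropic extensions; dependent ones are charged all
  \<open>2 ^ N\<close> vectors.\<close>

lemma iso_count_Suc_le: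
  "real (iso_count (Suc k)) \<le> real (iso_count k) * (2 ^ N / 2 ^ k) + real (bad_count k) * 2 ^ N"
proof -
  have step: "real (card {z \<in> vecs X. isotropic K (z # zs)})
      \<le> of_bool (isotropic K zs) * (2 ^ N / 2 ^ k) + of_bool (\<not> indep (form_radical X K) zs) * 2 ^ N"
    if zs: "zs \<in> klists k (vecs X)" for zs
  proof (cases "isotropic K zs")
    case True
    then have eq: "{z \<in> vecs X. isotropic K (z # zs)} = {z \<in> vecs X. \<forall>y\<in>set zs. offdiag_form K z y = 0}"
      by simp
    show ?thesis
    proof (cases "indep (form_radical X K) zs")
      case True
      then show ?thesis
        using \<open>isotropic K zs\<close> annihilator_eq[OF zs True] unfolding eq by simp
    next
      case False
      have "card {z \<in> vecs X. isotropic K (z # zs)} \<le> card (vecs X)"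
        using finite_X by (intro card_mono) auto
      then have "real (card {z \<in> vecs X. isotropic K (z # zs)}) \<le> 2 ^ N"
        unfolding card_V[symmetric] by (simp only: of_nat_le_iff)
      then show ?thesis
        using False by (simp only: of_bool_eq simp_thms) (simp add: add_increasing)
    qed
  qed simp
  have "real (iso_count (Suc k)) \<le> (\<Sum>zs\<in>klists k (vecs X).
      of_bool (isotropic K zs) * (2 ^ N / 2 ^ k) + of_bool (\<not> indep (form_radical X K) zs) * 2 ^ N)"
    unfolding iso_count_def card_klists_Suc_real[OF finite_vecs[OF finite_X]]
    by (intro sum_mono step)
  also have "\<dots> = real (iso_count k) * (2 ^ N / 2 ^ k) + real (bad_count k) * 2 ^ N"
    unfolding iso_count_def bad_count_def card_filter_real[OF finite_klists_V] sum_distrib_right sum.distrib ..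
  finally show ?thesis .
qed

text \<open>The exponents just fit: k(k-1)/2 + k from the weight plus k/2 from
  \<open>bad_count_le_sqrt\<close> is (k+1)^2/2 - 1/2. The constant \<open>3\<close> absorbs the
  accumulated error because c + 1 \<le> c * sqrt 2 holds for c = 3.\<close>

lemma normalize_iso_le:
  "normalize k (iso_count k) \<le> 1 + 3 * (sqrt 2 * (1 / sqrt 2) ^ card K) * sqrt 2 ^ (k * k)"
proof (induction k)
  case 0
  then show ?case
    by (simp add: normalize_def iso_count_0)
next
  case (Suc k)
  define s \<sigma> t :: real where "s = sqrt 2" and "\<sigma> = s * (1 / s) ^ card K" and "t = s ^ (2 * k)"
  have s: "s > 0" "3 * s \<ge> 4"
  proof -
    show "s > 0"
      by (simp add: s_def)
    show "3 * s \<ge> 4"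
      by (rule power2_le_imp_le) (auto simp: s_def power_mult_distrib)
  qed
  have \<sigma>: "\<sigma> \<ge> 0"
    using s by (simp add: \<sigma>_def)
  have t: "t \<ge> 1"
    by (simp add: t_def s_def power_mult)
  have "normalize (Suc k) (iso_count (Suc k))
      \<le> 2 ^ tri_num k / 2 ^ (N * k) * (2 ^ k / 2 ^ N * (real (iso_count k) * (2 ^ N / 2 ^ k) + real (bad_count k) * 2 ^ N))"
    unfolding normalize_Suc by (intro mult_left_mono iso_count_Suc_le) auto
  also have "\<dots> = normalize k (iso_count k) + 2 ^ (tri_num k + k) * (real (bad_count k) / 2 ^ (N * k))"
    by (simp add: normalize_def distrib_left power_add)
  also have "\<dots> \<le> (1 + 3 * \<sigma> * s ^ (k * k)) + 2 ^ (tri_num k + k) * (s ^ k * \<sigma>)"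
    using Suc bad_count_le_sqrt[of k] unfolding s_def \<sigma>_def by (intro add_mono mult_left_mono) auto
  also have "2 ^ (tri_num k + k) * (s ^ k * \<sigma>) = \<sigma> * s ^ (k * k) * t"
  proof -
    have "2 ^ (tri_num k + k) * s ^ k = s ^ (2 * (tri_num k + k) + k)"
      unfolding two_power_eq_sqrt s_def by (rule power_add[symmetric])
    also have "2 * (tri_num k + k) + k = k * k + 2 * k"
      using twice_triangle[of k] by simp
    finally show ?thesis
      by (simp add: power_add t_def)
  qed
  also have "(1 + 3 * \<sigma> * s ^ (k * k)) + \<sigma> * s ^ (k * k) * t = 1 + \<sigma> * s ^ (k * k) * (3 + t)"
    by (simp add: algebra_simps)
  also have "\<dots> \<le> 1 + \<sigma> * s ^ (k * k) * (3 * s * t)"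
  proof -
    have "3 + t \<le> 4 * t"
      using t by simp
    also have "\<dots> \<le> 3 * s * t"
      using s t by (intro mult_right_mono) auto
    finally have "3 + t \<le> 3 * s * t" .
    then show ?thesis
      using \<sigma> s by (intro add_left_mono mult_left_mono) auto
  qed
  also have "\<sigma> * s ^ (k * k) * (3 * s * t) = 3 * \<sigma> * s ^ (Suc k * Suc k)"
    by (simp add: t_def power_add mult_2)
  finally show ?case
    unfolding s_def \<sigma>_def .
qed

text \<open>The constant \<open>8\<close> comes from the lower bound: 4^k \<le> 4 * sqrt 2 ^ (k * k)
  since (k - 2)^2 \<ge> 0, and the remaining factor is at most twice
  \<open>(1 / sqrt 2) ^ card K\<close>. The upper bound has the smaller constant 3 * sqrt 2.\<close>

lemma moment_close:
  assumes d: "\<And>A. A \<in> \<A> \<Longrightarrow> card (kern X (red A)) = 2 ^ d A"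
    and off1: "card (X - Y) \<le> 1"
  shows "\<bar>(\<Sum>A\<in>\<A>. inj_count k (d A)) / real (card \<A>) - 1\<bar> \<le> 8 * (1 / sqrt 2) ^ card K * sqrt 2 ^ (k * k)"
proof -
  define s e :: real where "s = sqrt 2" and "e = (1 / s) ^ card K"
  have s: "s \<ge> 1" "s ^ 4 = 4"
    by (simp_all add: s_def numeral_eq_Suc)
  have e: "0 \<le> e" "e \<le> 1"
    using s by (auto simp: e_def power_le_one)
  have "normalize k (good_count k) \<le> normalize k (iso_count k)"
    unfolding normalize_def good_count_def iso_count_def
    by (intro mult_left_mono of_nat_mono card_mono) auto
  also have "\<dots> \<le> 1 + 3 * s * e * s ^ (k * k)"
    using normalize_iso_le[of k] by (simp add: s_def e_def mult.assoc)
  also have "\<dots> \<le> 1 + 8 * e * s ^ (k * k)"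
  proof -
    have "s \<le> 2"
      unfolding s_def by (rule real_le_lsqrt) auto
    then have "3 * s * e * s ^ (k * k) \<le> 8 * e * s ^ (k * k)"
      using e s by (intro mult_right_mono) auto
    then show ?thesis
      by simp
  qed
  finally have upper: "normalize k (good_count k) \<le> 1 + 8 * e * s ^ (k * k)" .
  have "4 ^ k * (2 ^ card (X - Y) / 2 ^ N) \<le> (4 * s ^ (k * k)) * (2 * e)"
  proof (rule mult_mono)
    have "(4::real) ^ k = s ^ (4 * k)"
      by (simp add: power_mult s(2))
    also have "\<dots> \<le> s ^ (k * k + 4)"
    proof (rule power_increasing[OF _ s(1)])
      have "0 \<le> (int k - 2)\<^sup>2"
        by simp
      then have "int (4 * k) \<le> int (k * k + 4)"
        by (simp add: power2_eq_square algebra_simps)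
      then show "4 * k \<le> k * k + 4"
        by (simp only: of_nat_le_iff)
    qed
    also have "s ^ (k * k + 4) = 4 * s ^ (k * k)"
      by (simp add: power_add s(2))
    finally show "(4::real) ^ k \<le> 4 * s ^ (k * k)" .
    have "(2::real) ^ card (X - Y) \<le> 2 ^ 1"
      using off1 by (intro power_increasing) auto
    moreover have "1 / (2::real) ^ N \<le> e"
    proof -
      have "(1/2::real) ^ N \<le> (1/2) ^ card K"
        using card_mono[OF finite_X K_subset] by (intro power_decreasing) auto
      also have "\<dots> = e * e"
        by (simp add: e_def s_def flip: power_mult_distrib)
      also have "\<dots> \<le> e"
        using e by (simp add: mult_left_le)
      finally show ?thesis
        by (simp add: power_one_over)
    qed
    ultimately have "2 ^ card (X - Y) * (1 / 2 ^ N) \<le> 2 * e"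
      using e by (intro mult_mono) auto
    then show "2 ^ card (X - Y) / 2 ^ N \<le> 2 * e"
      by simp
  qed (use s in auto)
  then have "1 - normalize k (good_count k) \<le> 8 * e * s ^ (k * k)"
    using normalize_good_ge[of k] by (simp add: mult_ac)
  moreover have "(\<Sum>A\<in>\<A>. inj_count k (d A)) / real (card \<A>) = normalize k (good_count k)"
    by (rule sum_inj_count) (rule d)
  ultimately show ?thesis
    using upper by (simp add: abs_le_iff s_def e_def)
qed

end

section \<open>From moments to distributions\<close>

text \<open>Bounded support makes the moments of order above \<open>n\<close> vanish, so the series
  is a finite sum and the summations may be exchanged.\<close>

lemma inversion_sums:
  fixes P :: "nat \<Rightarrow> real" and n :: nat
  defines "M \<equiv> \<lambda>k. \<Sum>x\<le>n. P x * inj_count k x"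
  assumes supp: "\<And>x. x > n \<Longrightarrow> P x = 0"
  shows "(\<lambda>m. inversion_coeff j m * M (j + m)) sums P j"
proof -
  have "(\<lambda>m. inversion_coeff j m * M (j + m)) sums (\<Sum>m\<le>n. inversion_coeff j m * M (j + m))"
    by (rule sums_finite) (auto simp: M_def inj_count_eq_0)
  also have "(\<Sum>m\<le>n. inversion_coeff j m * M (j + m))
      = (\<Sum>m\<le>n. \<Sum>x\<le>n. P x * (inversion_coeff j m * inj_count (j + m) x))"
    unfolding M_def sum_distrib_left by (simp only: mult.left_commute)
  also have "\<dots> = (\<Sum>x\<le>n. P x * (\<Sum>m\<le>n. inversion_coeff j m * inj_count (j + m) x))"
    unfolding sum_distrib_left by (rule sum.swap)
  also have "\<dots> = (\<Sum>x\<le>n. if x = j then P x else 0)"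
    by (intro sum.cong) (auto simp: inversion)
  also have "\<dots> = P j"
    using supp[of j] by auto
  finally show ?thesis .
qed

text \<open>The constant is 4 * 4, from \<open>qpoch\<close> at \<open>j\<close> and at
  \<open>m\<close>. The exponent is exact: twice \<open>j * j + (tri_num m + m + j * m)\<close> is
  j^2 + m + (j + m)^2, whose last square cancels the power of sqrt 2.\<close>

lemma abs_inversion_coeff_le:
  "\<bar>inversion_coeff j m\<bar> * sqrt 2 ^ ((j + m) * (j + m)) \<le> 16 * (1 / sqrt 2) ^ (j * j) * (1 / sqrt 2) ^ m"
proof -
  define h :: real where "h = 1 / sqrt 2"
  have half: "(1/2::real) ^ n = h ^ (2 * n)" for n
    by (simp add: h_def power_divide power_mult)
  have "(1/2) ^ (j * j) / qpoch j \<le> (1/2) ^ (j * j) / (1/4)"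
    by (intro divide_left_mono qpoch_ge_quarter) simp_all
  then have "(1/2) ^ (j * j) / qpoch j * \<bar>euler_term j m\<bar>
      \<le> ((1/2) ^ (j * j) / (1/4)) * (4 * (1/2) ^ (tri_num m + m + j * m))"
    by (intro mult_mono abs_euler_term_le) simp_all
  also have "\<dots> = 16 * (1/2) ^ (j * j + (tri_num m + m + j * m))"
    unfolding power_add[of _ "j * j"] by simp
  also have "(1/2) ^ (j * j) / qpoch j * \<bar>euler_term j m\<bar> = \<bar>inversion_coeff j m\<bar>"
    using qpoch_pos[of j] by (simp add: inversion_coeff_def abs_mult abs_of_pos del: qpoch_pos)
  finally have "\<bar>inversion_coeff j m\<bar> \<le> 16 * (1/2) ^ (j * j + (tri_num m + m + j * m))" .
  also have "\<dots> = 16 * h ^ (2 * (j * j + (tri_num m + m + j * m)))"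
    by (simp only: half)
  also have "2 * (j * j + (tri_num m + m + j * m)) = j * j + m + (j + m) * (j + m)"
    using twice_triangle[of m] by (simp add: algebra_simps)
  finally have "\<bar>inversion_coeff j m\<bar> * sqrt 2 ^ ((j + m) * (j + m))
      \<le> 16 * h ^ (j * j + m + (j + m) * (j + m)) * sqrt 2 ^ ((j + m) * (j + m))"
    by (rule mult_right_mono) simp
  also have "\<dots> = 16 * h ^ (j * j + m) * (h * sqrt 2) ^ ((j + m) * (j + m))"
    by (simp only: power_add[of h "j * j + m"] power_mult_distrib mult.assoc)
  also have "h * sqrt 2 = 1"
    by (simp add: h_def)
  finally show ?thesis
    by (simp add: h_def power_add)
qed

text \<open>The inversion coefficients decay like \<open>2\<close> to the power \<open>- (j + m)\<^sup>2 / 2 - j\<^sup>2 / 2 - m / 2\<close>, so they absorb errors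
  in the moments which grow like \<open>2\<close> to the power \<open>(j + m)\<^sup>2 / 2\<close>.\<close>

lemma distribution_close:
  fixes P :: "nat \<Rightarrow> real"
  assumes supp: "\<And>x. x > n \<Longrightarrow> P x = 0"
    and close: "\<And>k. \<bar>(\<Sum>x\<le>n. P x * inj_count k x) - 1\<bar> \<le> E * sqrt 2 ^ (k * k)"
  shows "\<bar>P j - pi_CL j\<bar> \<le> 16 * E / (1 - 1 / sqrt 2) * (1 / sqrt 2) ^ (j * j)"
proof -
  define h :: real where "h = 1 / sqrt 2"
  have h: "0 < h" "h < 1"
    by (simp_all add: h_def)
  define M where "M = (\<lambda>k. \<Sum>x\<le>n. P x * inj_count k x)"
  define f where "f m = inversion_coeff j m * M (j + m) - inversion_coeff j m" for m
  have f: "f sums (P j - pi_CL j)"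
    unfolding f_def M_def by (intro sums_diff inversion_sums supp inversion_coeff_sums)
  have bound: "norm (f m) \<le> 16 * E * h ^ (j * j) * h ^ m" for m
  proof -
    have "0 \<le> E * sqrt 2 ^ (0 * 0)"
      using close[of 0] by (rule order_trans[OF abs_ge_zero])
    then have E: "0 \<le> E"
      by simp
    have "norm (f m) = \<bar>inversion_coeff j m\<bar> * \<bar>M (j + m) - 1\<bar>"
      by (simp add: f_def right_diff_distrib flip: abs_mult)
    also have "\<dots> \<le> \<bar>inversion_coeff j m\<bar> * (E * sqrt 2 ^ ((j + m) * (j + m)))"
      using close[of "j + m"] unfolding M_def by (rule mult_left_mono) simp
    also have "\<dots> = E * (\<bar>inversion_coeff j m\<bar> * sqrt 2 ^ ((j + m) * (j + m)))"
      by (rule mult.left_commute)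
    also have "\<dots> \<le> E * (16 * h ^ (j * j) * h ^ m)"
      unfolding h_def by (intro mult_left_mono abs_inversion_coeff_le E)
    finally show ?thesis
      by (simp add: mult_ac)
  qed
  have g: "(\<lambda>m. 16 * E * h ^ (j * j) * h ^ m) sums (16 * E * h ^ (j * j) * (1 / (1 - h)))"
    using h by (intro sums_mult geometric_sums) auto
  have "\<bar>P j - pi_CL j\<bar> = norm (suminf f)"
    using sums_unique[OF f] by simp
  also have "\<dots> \<le> suminf (\<lambda>m. 16 * E * h ^ (j * j) * h ^ m)"
    by (rule norm_suminf_le[OF bound sums_summable[OF g]])
  also have "\<dots> = 16 * E / (1 - h) * h ^ (j * j)"
    using sums_unique[OF g] by simp
  finally show ?thesis
    by (simp add: h_def)
qed

lemma l1_norm_le: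
  assumes "\<And>j. \<bar>f j\<bar> \<le> c * (1 / sqrt 2) ^ (j * j)" "c \<ge> 0"
  shows "l1_norm f \<le> ennreal (c / (1 - 1 / sqrt 2))"
proof -
  define h :: real where "h = 1 / sqrt 2"
  have h: "0 < h" "h < 1"
    by (simp_all add: h_def)
  have "\<bar>f j\<bar> \<le> c * h ^ j" for j
  proof -
    have "h ^ (j * j) \<le> h ^ j"
      using h by (intro power_decreasing) (auto simp: le_square)
    then show ?thesis
      using assms(1)[of j] mult_left_mono[OF _ assms(2)] unfolding h_def by (meson order_trans)
  qed
  then have "l1_norm f \<le> (\<Sum>j. ennreal (c * h ^ j))"
    unfolding l1_norm_def by (intro suminf_le ennreal_leI) auto
  also have "(\<lambda>j. c * h ^ j) sums (c * (1 / (1 - h)))"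
    using h by (intro sums_mult geometric_sums) auto
  then have "(\<Sum>j. ennreal (c * h ^ j)) = ennreal (c * (1 / (1 - h)))"
    using h assms(2) by (intro suminf_ennreal_eq) auto
  finally show ?thesis
    by (simp add: h_def)
qed

lemma l1_norm_triangle: "l1_norm (\<lambda>j. f j - g j) \<le> l1_norm f + l1_norm g"
proof -
  have "l1_norm (\<lambda>j. f j - g j) \<le> (\<Sum>j. ennreal \<bar>f j\<bar> + ennreal \<bar>g j\<bar>)"
    unfolding l1_norm_def
    by (intro suminf_le) (auto simp: abs_triangle_ineq4 simp flip: ennreal_plus intro!: ennreal_leI)
  also have "\<dots> = l1_norm f + l1_norm g"
    unfolding l1_norm_def by (rule suminf_add[symmetric]) auto
  finally show ?thesis .
qed

lemma l1_norm_mixture: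
  assumes "finite I" "\<And>i. i \<in> I \<Longrightarrow> b i \<ge> 0"
  shows "l1_norm (\<lambda>j. \<Sum>i\<in>I. b i * f i j) \<le> (\<Sum>i\<in>I. ennreal (b i) * l1_norm (f i))"
proof -
  have "ennreal \<bar>\<Sum>i\<in>I. b i * f i j\<bar> \<le> (\<Sum>i\<in>I. ennreal (b i) * ennreal \<bar>f i j\<bar>)" for j
  proof -
    have "\<bar>\<Sum>i\<in>I. b i * f i j\<bar> \<le> (\<Sum>i\<in>I. b i * \<bar>f i j\<bar>)"
      using sum_abs[of "\<lambda>i. b i * f i j" I] assms by (simp add: abs_mult)
    then have "ennreal \<bar>\<Sum>i\<in>I. b i * f i j\<bar> \<le> ennreal (\<Sum>i\<in>I. b i * \<bar>f i j\<bar>)"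
      by (rule ennreal_leI)
    also have "\<dots> = (\<Sum>i\<in>I. ennreal (b i * \<bar>f i j\<bar>))"
      using assms by (intro sum_ennreal[symmetric]) auto
    also have "\<dots> = (\<Sum>i\<in>I. ennreal (b i) * ennreal \<bar>f i j\<bar>)"
      using assms by (intro sum.cong) (auto simp: ennreal_mult)
    finally show ?thesis .
  qed
  then have "l1_norm (\<lambda>j. \<Sum>i\<in>I. b i * f i j) \<le> (\<Sum>j. \<Sum>i\<in>I. ennreal (b i) * ennreal \<bar>f i j\<bar>)"
    unfolding l1_norm_def by (intro suminf_le) auto
  also have "\<dots> = (\<Sum>i\<in>I. \<Sum>j. ennreal (b i) * ennreal \<bar>f i j\<bar>)"
    by (rule suminf_sum) auto
  also have "\<dots> = (\<Sum>i\<in>I. ennreal (b i) * l1_norm (f i))"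
    unfolding l1_norm_def by (intro sum.cong refl ennreal_suminf_cmult)
  finally show ?thesis .
qed

text \<open>At \<open>x = 1\<close> this normalizes the weights; at \<open>x = 1 / sqrt 2\<close> it
  turns decay in \<open>\<kappa>\<close> into decay in \<open>r\<close>.\<close>

lemma sum_Binom_power: "(\<Sum>\<kappa>\<le>r. Binom r \<kappa> * x ^ \<kappa>) = ((1 + x) / 2) ^ r"
proof -
  have "(x + 1) ^ r = (\<Sum>\<kappa>\<le>r. real (r choose \<kappa>) * x ^ \<kappa>)"
    by (subst binomial_ring) simp
  then show ?thesis
    by (simp add: Binom_def power_divide add.commute sum_divide_distrib)
qed

lemma Binom_nonneg: "Binom r \<kappa> \<ge> 0"
  by (simp add: Binom_def)

lemma l1_norm_binomial_mixture:
  assumes "\<And>\<kappa>. \<kappa> \<le> r \<Longrightarrow> l1_norm (\<lambda>j. P \<kappa> j - pi_CL j) \<le> ennreal (c * (1 / sqrt 2) ^ \<kappa>)" and "c \<ge> 0"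
  shows "l1_norm (\<lambda>j. (\<Sum>\<kappa>\<le>r. Binom r \<kappa> * P \<kappa> j) - pi_CL j) \<le> ennreal (c * ((1 + 1 / sqrt 2) / 2) ^ r)"
proof -
  have "(\<Sum>\<kappa>\<le>r. Binom r \<kappa> * P \<kappa> j) - pi_CL j = (\<Sum>\<kappa>\<le>r. Binom r \<kappa> * (P \<kappa> j - pi_CL j))" for j
    using sum_Binom_power[of r 1] by (simp add: right_diff_distrib sum_subtractf flip: sum_distrib_right)
  then have "l1_norm (\<lambda>j. (\<Sum>\<kappa>\<le>r. Binom r \<kappa> * P \<kappa> j) - pi_CL j)
      \<le> (\<Sum>\<kappa>\<le>r. ennreal (Binom r \<kappa>) * l1_norm (\<lambda>j. P \<kappa> j - pi_CL j))"
    using l1_norm_mixture[of "{..r}" "Binom r"] by (simp add: Binom_nonneg)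
  also have "\<dots> \<le> (\<Sum>\<kappa>\<le>r. ennreal (Binom r \<kappa>) * ennreal (c * (1 / sqrt 2) ^ \<kappa>))"
    by (intro sum_mono mult_left_mono assms) auto
  also have "\<dots> = ennreal (\<Sum>\<kappa>\<le>r. Binom r \<kappa> * (c * (1 / sqrt 2) ^ \<kappa>))"
    using \<open>c \<ge> 0\<close> by (simp add: Binom_nonneg flip: ennreal_mult)
  also have "(\<Sum>\<kappa>\<le>r. Binom r \<kappa> * (c * (1 / sqrt 2) ^ \<kappa>)) = c * ((1 + 1 / sqrt 2) / 2) ^ r"
    unfolding sum_Binom_power[symmetric] sum_distrib_left by (simp only: mult.left_commute)
  finally show ?thesis .
qed

section \<open>Kernels and coranks of the matrices of a rule\<close>

lemma finite_carrier_vec_bit: "finite (carrier_vec n :: bit Matrix.vec set)"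
proof -
  have "(carrier_vec n :: bit Matrix.vec set) \<subseteq> (\<lambda>x. Matrix.vec n x) ` vecs {..<n}"
  proof
    fix v :: "bit Matrix.vec" assume "v \<in> carrier_vec n"
    define x where "x = (\<lambda>i. if i < n then v $ i else 0)"
    have "v = Matrix.vec n x"
      using \<open>v \<in> carrier_vec n\<close> by (intro eq_vecI) (auto simp: x_def)
    moreover have "x \<in> vecs {..<n}"
      by (simp add: x_def vecs_def)
    ultimately show "v \<in> (\<lambda>x. Matrix.vec n x) ` vecs {..<n}"
      by blast
  qed
  then show ?thesis
    by (rule finite_subset) simp
qed

text \<open>The kernel is finite and spans itself, hence is finite-dimensional; coordinates in a
  basis identify it with the functions from the basis to the field.\<close>

lemma card_mat_kernel:
  fixes A :: "bit mat"
  assumes A: "A \<in> carrier_mat nr nc"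
  shows "card (mat_kernel A) = 2 ^ kernel_dim A"
proof -
  interpret kernel nr nc A
    by unfold_locales (rule A)
  have fin: "finite (mat_kernel A)"
    by (rule finite_subset[OF _ finite_carrier_vec_bit[of nc]]) (use mat_kernel[OF A] in auto)
  have "span (mat_kernel A) = mat_kernel A"
    using Ker.span_is_subset2[of "mat_kernel A"] Ker.in_own_span[of "mat_kernel A"] by auto
  then have "Ker.fin_dim"
    unfolding Ker.fin_dim_def using fin by (intro exI[of _ "mat_kernel A"] conjI) auto
  then obtain B where B: "finite B" "basis B"
    using Ker.finite_basis_exists by blast
  then have sub: "B \<subseteq> mat_kernel A"
    by (simp add: Ker.basis_def)
  have uniq: "\<exists>!a. a \<in> B \<rightarrow>\<^sub>E UNIV \<and> lincomb a B = v" if "v \<in> mat_kernel A" for v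
    using Ker.basis_criterion[OF B(1) sub] B(2) that by simp
  have "bij_betw (\<lambda>a. lincomb a B) (B \<rightarrow>\<^sub>E UNIV) (mat_kernel A)"
    unfolding bij_betw_def
  proof
    have in_ker: "lincomb a B \<in> mat_kernel A" for a
      using Ker.lincomb_closed[OF sub, of a] by simp
    show "inj_on (\<lambda>a. lincomb a B) (B \<rightarrow>\<^sub>E UNIV)"
      using uniq[OF in_ker] by (intro inj_onI) blast
    show "(\<lambda>a. lincomb a B) ` (B \<rightarrow>\<^sub>E UNIV) = mat_kernel A"
      using uniq in_ker by blast
  qed
  then have "card (mat_kernel A) = card (B \<rightarrow>\<^sub>E (UNIV :: bit set))"
    by (simp add: bij_betw_same_card)
  also have "(UNIV :: bit set) = {0, 1}"
    by (auto intro: bit.exhaust)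
  also have "card (B \<rightarrow>\<^sub>E {0, 1 :: bit}) = 2 ^ card B"
    using B by (simp add: card_PiE) (simp add: numeral_2_eq_2)
  also have "card B = kernel_dim A"
    using Ker.dim_basis[OF B] by simp
  finally show ?thesis .
qed

definition mat_of :: "nat \<Rightarrow> (nat \<Rightarrow> nat \<Rightarrow> bit) \<Rightarrow> bit mat" where
  "mat_of r A = mat r r (\<lambda>(i, j). A i j)"

lemma card_mat_kernel_mat_of: "2 ^ kernel_dim (mat_of r A) = card (kern {..<r} A)"
proof -
  have "bij_betw (\<lambda>x. Matrix.vec r x) (kern {..<r} A) (mat_kernel (mat_of r A))"
  proof (rule bij_betw_byWitness[where f' = "\<lambda>v i. if i < r then v $ i else 0"])
    have row: "(mat_of r A *\<^sub>v v) $ i = (\<Sum>j\<in>{..<r}. A i j * v $ j)" if "i < r" "v \<in> carrier_vec r" for v i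
      using that by (auto simp: mat_of_def scalar_prod_def atLeast0LessThan intro!: sum.cong)
    have mv: "(mat_of r A *\<^sub>v v = 0\<^sub>v r) \<longleftrightarrow> (\<forall>i<r. (\<Sum>j\<in>{..<r}. A i j * v $ j) = 0)" if "v \<in> carrier_vec r" for v
    proof
      assume eq: "mat_of r A *\<^sub>v v = 0\<^sub>v r"
      show "\<forall>i<r. (\<Sum>j\<in>{..<r}. A i j * v $ j) = 0"
        using row[OF _ that] unfolding eq by simp
    next
      assume "\<forall>i<r. (\<Sum>j\<in>{..<r}. A i j * v $ j) = 0"
      then show "mat_of r A *\<^sub>v v = 0\<^sub>v r"
        using row[OF _ that] by (intro eq_vecI) (auto simp: mat_of_def)
    qed
    have ker: "v \<in> mat_kernel (mat_of r A) \<longleftrightarrow>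
        v \<in> carrier_vec r \<and> (\<forall>i<r. (\<Sum>j\<in>{..<r}. A i j * v $ j) = 0)" for v
      using mv by (auto simp: mat_kernel_def) (auto simp: mat_of_def)
    have kern: "x \<in> kern {..<r} A \<longleftrightarrow> x \<in> vecs {..<r} \<and> (\<forall>i<r. (\<Sum>j\<in>{..<r}. A i j * x j) = 0)" for x
      by (auto simp: kern_def mulv_def fun_eq_iff)
    show "\<forall>x\<in>kern {..<r} A. (\<lambda>i. if i < r then Matrix.vec r x $ i else 0) = x"
      by (auto simp: kern vecs_def fun_eq_iff)
    show "\<forall>v\<in>mat_kernel (mat_of r A). Matrix.vec r (\<lambda>i. if i < r then v $ i else 0) = v"
      by (auto simp: ker intro!: eq_vecI)
    show "(\<lambda>x. Matrix.vec r x) ` kern {..<r} A \<subseteq> mat_kernel (mat_of r A)"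
      by (auto simp: ker kern)
    show "(\<lambda>v i. if i < r then v $ i else 0) ` mat_kernel (mat_of r A) \<subseteq> kern {..<r} A"
      by (auto simp: ker kern vecs_def)
  qed
  then show ?thesis
    using card_mat_kernel[of "mat_of r A" r r] by (simp add: mat_of_def bij_betw_same_card)
qed

text \<open>Schur complement with respect to the entry at \<open>(0, 0)\<close>, which is assumed to be \<open>1\<close>.  The indices
  are not shifted, so that only \<open>i, j > 0\<close> are meaningful.\<close>

definition schur :: "(nat \<Rightarrow> nat \<Rightarrow> bit) \<Rightarrow> nat \<Rightarrow> nat \<Rightarrow> bit" where
  "schur A i j = A i j + A i 0 * A 0 j"

text \<open>Row 0 of the system reads x 0 = f x; substituting this into the other rows gives the
  Schur complement. Forgetting coordinate 0 is the bijection.\<close>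

lemma card_kern_schur:
  assumes A: "A 0 0 = 1" and r: "r > 0"
  shows "card (kern {..<r} A) = card (kern {1..<r} (schur A))"
proof -
  let ?X = "{1..<r}"
  define f where "f y = (\<Sum>j\<in>?X. A 0 j * y j)" for y
  have X: "{..<r} = insert 0 ?X"
    using r by auto
  have sum: "(\<Sum>j\<in>{..<r}. A i j * x j) = A i 0 * x 0 + (\<Sum>j\<in>?X. A i j * x j)" for i x
    unfolding X by simp
  have sumS: "(\<Sum>j\<in>?X. schur A i j * x j) = (\<Sum>j\<in>?X. A i j * x j) + A i 0 * f x" for i x
    by (simp add: schur_def f_def distrib_right sum.distrib sum_distrib_left mult.assoc)
  have k1: "x \<in> kern {..<r} A \<longleftrightarrow> x \<in> vecs {..<r} \<and> x 0 = f x \<and>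
      (\<forall>i\<in>?X. (\<Sum>j\<in>?X. schur A i j * x j) = 0)" for x
  proof -
    have "x \<in> kern {..<r} A \<longleftrightarrow> x \<in> vecs {..<r} \<and> (\<forall>i\<in>insert 0 ?X. (\<Sum>j\<in>{..<r}. A i j * x j) = 0)"
      unfolding X[symmetric] by (auto simp: kern_def mulv_def fun_eq_iff)
    also have "\<dots> \<longleftrightarrow> x \<in> vecs {..<r} \<and> x 0 = f x \<and> (\<forall>i\<in>?X. A i 0 * x 0 + (\<Sum>j\<in>?X. A i j * x j) = 0)"
      unfolding sum by (simp add: A bit_add_eq_0_iff f_def)
    also have "\<dots> \<longleftrightarrow> x \<in> vecs {..<r} \<and> x 0 = f x \<and> (\<forall>i\<in>?X. (\<Sum>j\<in>?X. schur A i j * x j) = 0)"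
      unfolding sumS by (auto simp: add.commute)
    finally show ?thesis .
  qed
  have k2: "x \<in> kern ?X (schur A) \<longleftrightarrow> x \<in> vecs ?X \<and> (\<forall>i\<in>?X. (\<Sum>j\<in>?X. schur A i j * x j) = 0)" for x
    by (auto simp: kern_def mulv_def fun_eq_iff)
  have upd: "(\<Sum>j\<in>?X. B j * (x(0 := c)) j) = (\<Sum>j\<in>?X. B j * x j)" for B x and c :: bit
    by (intro sum.cong) auto
  have "bij_betw (\<lambda>x. x(0 := 0)) (kern {..<r} A) (kern ?X (schur A))"
  proof (rule bij_betw_byWitness[where f' = "\<lambda>x. x(0 := f x)"])
    have fupd: "f (x(0 := c)) = f x" for x c
      unfolding f_def by (rule upd)
    show "\<forall>x\<in>kern {..<r} A. (x(0 := 0))(0 := f (x(0 := 0))) = x"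
      by (auto simp: k1 fupd fun_eq_iff)
    show "\<forall>x\<in>kern ?X (schur A). (x(0 := f x))(0 := 0) = x"
      by (auto simp: k2 vecs_def fun_eq_iff simp del: One_nat_def)
    show "(\<lambda>x. x(0 := 0)) ` kern {..<r} A \<subseteq> kern ?X (schur A)"
    proof (intro image_subsetI)
      fix x assume "x \<in> kern {..<r} A"
      then show "x(0 := 0) \<in> kern ?X (schur A)"
        unfolding k1 k2 upd by (auto simp: vecs_def)
    qed
    show "(\<lambda>x. x(0 := f x)) ` kern ?X (schur A) \<subseteq> kern {..<r} A"
    proof (intro image_subsetI)
      fix x assume "x \<in> kern ?X (schur A)"
      then show "x(0 := f x) \<in> kern {..<r} A"
        unfolding k1 k2 upd fupd using r by (auto simp: vecs_def)
    qed
  qed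
  then show ?thesis
    by (rule bij_betw_same_card)
qed

definition encode :: "(nat \<Rightarrow> nat \<Rightarrow> bit) \<Rightarrow> nat \<Rightarrow> step" where
  "encode A i = (Matrix.vec i (A i), Matrix.vec i (\<lambda>j. A j i), A i i)"

text \<open>Requiring zeros outside the \<open>r\<close> by \<open>r\<close> block makes a member
  the same thing as a choice of the first \<open>r\<close> steps of the rule.\<close>

definition family :: "(nat \<Rightarrow> step set) \<Rightarrow> nat \<Rightarrow> (nat \<Rightarrow> nat \<Rightarrow> bit) set" where
  "family S r = {A. (\<forall>i j. i \<ge> r \<or> j \<ge> r \<longrightarrow> A i j = 0) \<and> (\<forall>i<r. encode A i \<in> S i)}"

lemma omega_cong: "(\<And>i. i < r \<Longrightarrow> B i = B' i) \<Longrightarrow> omega r B = omega r B'"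
  by (induction r) auto

lemma omega_encode: "omega r (encode A) = mat_of r A"
proof (induction r)
  case (Suc r)
  have "omega (Suc r) (encode A) = extend_mat (mat_of r A) (Matrix.vec r (A r)) (Matrix.vec r (\<lambda>j. A j r)) (A r r)"
    by (simp add: Suc encode_def)
  also have "\<dots> = mat_of (Suc r) A"
    by (rule eq_matI) (auto simp: extend_mat_def mat_of_def Let_def less_Suc_eq)
  finally show ?case .
qed (auto simp: mat_of_def intro!: eq_matI)

lemma bij_betw_family:
  assumes "is_rule S"
  shows "bij_betw (\<lambda>A. restrict (encode A) {..<r}) (family S r) (Pi\<^sub>E {..<r} S)"
proof (rule bij_betw_byWitness[where f' = "\<lambda>f i j. if i < r \<and> j < r then
    (if j < i then fst (f i) $ j else if i < j then fst (snd (f j)) $ i else snd (snd (f i))) else 0"])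
  let ?d = "\<lambda>f i j. if i < r \<and> j < r then
    (if j < i then fst (f i) $ j else if i < j then fst (snd (f j)) $ i else snd (snd (f i))) else 0"
  have dec: "encode (?d f) i = f i" if f: "f \<in> Pi\<^sub>E {..<r} S" and i: "i < r" for f i
  proof -
    have "f i \<in> carrier_vec i \<times> carrier_vec i \<times> UNIV"
      using f i assms by (auto simp: is_rule_def PiE_iff)
    then obtain v w c where fi: "f i = (v, w, c)" "v \<in> carrier_vec i" "w \<in> carrier_vec i"
      by (cases "f i") auto
    show ?thesis
      unfolding encode_def fi(1) using fi i by (auto intro!: eq_vecI)
  qed
  show "\<forall>A\<in>family S r. ?d (restrict (encode A) {..<r}) = A"
  proof (intro ballI ext)
    fix A i j assume "A \<in> family S r"
    then have out: "A i j = 0" if "\<not> (i < r \<and> j < r)"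
      using that by (auto simp: family_def)
    show "?d (restrict (encode A) {..<r}) i j = A i j"
    proof (cases "i < r \<and> j < r")
      case True
      then show ?thesis
        by (cases i j rule: linorder_cases) (simp_all add: encode_def)
    next
      case False
      show ?thesis
        unfolding out[OF False] using False by (simp only: if_False)
    qed
  qed
  show "\<forall>f\<in>Pi\<^sub>E {..<r} S. restrict (encode (?d f)) {..<r} = f"
  proof
    fix f assume f: "f \<in> Pi\<^sub>E {..<r} S"
    show "restrict (encode (?d f)) {..<r} = f"
    proof
      fix i
      show "restrict (encode (?d f)) {..<r} i = f i"
      proof (cases "i < r")
        case True
        then show ?thesis
          using dec[OF f True] by (simp only: restrict_apply' lessThan_iff)
      next
        case False
        then show ?thesis
          using PiE_arb[OF f, of i] by simp
      qed
    qed
  qed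
  show "(\<lambda>A. restrict (encode A) {..<r}) ` family S r \<subseteq> Pi\<^sub>E {..<r} S"
    by (simp add: image_subset_iff restrict_PiE_iff family_def)
  show "?d ` Pi\<^sub>E {..<r} S \<subseteq> family S r"
  proof
    fix A assume "A \<in> ?d ` Pi\<^sub>E {..<r} S"
    then obtain f where f: "f \<in> Pi\<^sub>E {..<r} S" "A = ?d f"
      by blast
    have "encode A i \<in> S i" if "i < r" for i
      unfolding f(2) dec[OF f(1) that] using PiE_mem[OF f(1)] that by simp
    moreover have "A i j = 0" if "i \<ge> r \<or> j \<ge> r" for i j
      unfolding f(2) using that by auto
    ultimately show "A \<in> family S r"
      unfolding family_def by blast
  qed
qed

lemma finite_rule: "is_rule S \<Longrightarrow> finite (S i)"
  unfolding is_rule_def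
  by (rule finite_subset[of _ "carrier_vec i \<times> carrier_vec i \<times> {0, 1}"])
     (auto simp: finite_carrier_vec_bit intro: bit.exhaust)

lemma finite_family: "is_rule S \<Longrightarrow> finite (family S r)"
  using bij_betw_finite[OF bij_betw_family] by (simp add: finite_PiE finite_rule)

lemma family_nonempty:
  assumes "is_rule S"
  shows "family S r \<noteq> {}"
proof -
  have "Pi\<^sub>E {..<r} S \<noteq> {}"
    using assms by (simp add: PiE_eq_empty_iff is_rule_def)
  then show ?thesis
    using bij_betw_imp_surj_on[OF bij_betw_family[OF assms, of r]] by (metis image_empty)
qed

text \<open>\<open>omega r\<close> reads only the first \<open>r\<close> coordinates, so the event
  is a finite disjoint union of cylinders of equal mass.\<close>

lemma corank_dist_eq_PiE:
  assumes S: "is_rule S"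
  shows "corank_dist S r j
    = real (card {f \<in> Pi\<^sub>E {..<r} S. kernel_dim (omega r f) = j}) / real (card (Pi\<^sub>E {..<r} S))"
proof -
  interpret product_prob_space "\<lambda>i. uniform_count_measure (S i)" UNIV
    by (rule product_prob_spaceI, rule prob_space_uniform_count_measure[OF finite_rule[OF S]])
       (use S in \<open>simp add: is_rule_def\<close>)
  let ?M = "\<lambda>i. uniform_count_measure (S i)"
  let ?F = "{f \<in> Pi\<^sub>E {..<r} S. kernel_dim (omega r f) = j}"
  define cyl where "cyl f = prod_emb UNIV ?M {..<r} (Pi\<^sub>E {..<r} (\<lambda>i. {f i}))" for f
  have finF: "finite ?F"
    by (simp add: finite_PiE finite_rule[OF S])
  have cyl_iff: "B \<in> cyl f \<longleftrightarrow> (\<forall>i. B i \<in> S i) \<and> restrict B {..<r} = f" if "f \<in> Pi\<^sub>E {..<r} S" for B f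
  proof -
    have "restrict B {..<r} = f \<longleftrightarrow> (\<forall>i<r. B i = f i)"
      using that by (auto simp: fun_eq_iff PiE_iff extensional_def)
    then show ?thesis
      by (auto simp: cyl_def prod_emb_iff space_uniform_count_measure PiE_iff)
  qed
  have omega_restrict: "omega r (restrict B {..<r}) = omega r B" for B
    by (rule omega_cong) simp
  have event: "{B \<in> space (rule_space S). corank_rv r B = j} = (\<Union>f\<in>?F. cyl f)"
  proof (rule Set.set_eqI)
    fix B
    have "B \<in> (\<Union>f\<in>?F. cyl f) \<longleftrightarrow> (\<exists>f\<in>?F. (\<forall>i. B i \<in> S i) \<and> restrict B {..<r} = f)"
      using cyl_iff by auto
    also have "\<dots> \<longleftrightarrow> (\<forall>i. B i \<in> S i) \<and> kernel_dim (omega r (restrict B {..<r})) = j"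
      by auto
    also have "\<dots> \<longleftrightarrow> B \<in> {B \<in> space (rule_space S). corank_rv r B = j}"
      by (auto simp: rule_space_def space_PiM PiE_iff space_uniform_count_measure corank_rv_def omega_restrict)
    finally show "B \<in> {B \<in> space (rule_space S). corank_rv r B = j} \<longleftrightarrow> B \<in> (\<Union>f\<in>?F. cyl f)"
      by blast
  qed
  have cyl_sets: "cyl f \<in> sets (rule_space S)" if "f \<in> ?F" for f
    unfolding cyl_def rule_space_def using that
    by (intro sets_PiM_I) (auto simp: sets_uniform_count_measure PiE_iff)
  have "corank_dist S r j = measure (rule_space S) (\<Union>f\<in>?F. cyl f)"
    unfolding corank_dist_def event ..
  also have "\<dots> = (\<Sum>f\<in>?F. measure (rule_space S) (cyl f))"
  proof (rule measure_finite_Union[OF finF])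
    show "cyl ` ?F \<subseteq> sets (rule_space S)"
      using cyl_sets by auto
    show "disjoint_family_on cyl ?F"
      unfolding disjoint_family_on_def using cyl_iff by auto
    show "emeasure (rule_space S) (cyl f) \<noteq> \<infinity>" for f
      by (simp add: rule_space_def)
  qed
  also have "\<dots> = (\<Sum>f\<in>?F. 1 / real (card (Pi\<^sub>E {..<r} S)))"
  proof (rule sum.cong)
    fix f assume f: "f \<in> ?F"
    have "measure (rule_space S) (cyl f) = (\<Prod>i<r. measure (?M i) {f i})"
      unfolding rule_space_def cyl_def using f
      by (intro measure_PiM_emb) (auto simp: sets_uniform_count_measure PiE_iff)
    also have "\<dots> = (\<Prod>i<r. 1 / real (card (S i)))"
      using f by (intro prod.cong) (auto simp: measure_uniform_count_measure finite_rule[OF S] PiE_iff)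
    also have "\<dots> = 1 / real (card (Pi\<^sub>E {..<r} S))"
      by (simp add: card_PiE prod_dividef)
    finally show "measure (rule_space S) (cyl f) = 1 / real (card (Pi\<^sub>E {..<r} S))" .
  qed simp
  finally show ?thesis
    by simp
qed

lemma corank_dist_eq_family:
  assumes S: "is_rule S"
  shows "corank_dist S r j = real (card {A \<in> family S r. kernel_dim (mat_of r A) = j}) / real (card (family S r))"
proof -
  note bij = bij_betw_family[OF S, of r]
  have om: "omega r (restrict (encode A) {..<r}) = mat_of r A" for A
    unfolding omega_encode[symmetric] by (rule omega_cong) simp
  have "bij_betw (\<lambda>A. restrict (encode A) {..<r}) {A \<in> family S r. kernel_dim (mat_of r A) = j}
    {f \<in> Pi\<^sub>E {..<r} S. kernel_dim (omega r f) = j}"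
    unfolding bij_betw_def
  proof
    show "inj_on (\<lambda>A. restrict (encode A) {..<r}) {A \<in> family S r. kernel_dim (mat_of r A) = j}"
      by (rule inj_on_subset[OF bij_betw_imp_inj_on[OF bij]]) auto
    show "(\<lambda>A. restrict (encode A) {..<r}) ` {A \<in> family S r. kernel_dim (mat_of r A) = j}
      = {f \<in> Pi\<^sub>E {..<r} S. kernel_dim (omega r f) = j}"
      unfolding bij_betw_imp_surj_on[OF bij, symmetric] using om by auto
  qed
  then show ?thesis
    unfolding corank_dist_eq_PiE[OF S] bij_betw_same_card[OF bij] by (simp only: bij_betw_same_card)
qed

lemma offdiag_form_entries:
  assumes X: "finite X" and Y: "Y \<subseteq> X" and K: "K \<subseteq> X"
    and entries: "\<And>i j. i \<in> X \<Longrightarrow> j \<in> X \<Longrightarrow>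
      (if i \<in> Y then M i j else 0) + (if j \<in> Y then M j i else 0) = of_bool (i \<noteq> j \<and> i \<in> K \<and> j \<in> K)"
  shows "dotp Y y (mulv X M z) + dotp Y z (mulv X M y) = offdiag_form K y z"
proof -
  define m where "m i j = (if i \<in> Y then M i j else 0)" for i j
  have expand: "dotp Y u (mulv X M v) = (\<Sum>i\<in>X. \<Sum>j\<in>X. u i * v j * m i j)" for u v
  proof -
    have "dotp Y u (mulv X M v) = (\<Sum>i\<in>Y. \<Sum>j\<in>X. u i * v j * m i j)"
      unfolding dotp_def mulv_def
    proof (rule sum.cong)
      fix i assume i: "i \<in> Y"
      then have "i \<in> X"
        using Y by blast
      then show "u i * (if i \<in> X then \<Sum>j\<in>X. M i j * v j else 0) = (\<Sum>j\<in>X. u i * v j * m i j)"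
        using i by (simp add: m_def sum_distrib_left mult.assoc mult.commute[of "v _"])
    qed simp
    also have "\<dots> = (\<Sum>i\<in>X. \<Sum>j\<in>X. u i * v j * m i j)"
      using X Y by (intro sum.mono_neutral_left) (auto simp: m_def)
    finally show ?thesis .
  qed
  have "dotp Y z (mulv X M y) = (\<Sum>i\<in>X. \<Sum>j\<in>X. z j * y i * m j i)"
    unfolding expand by (rule sum.swap)
  then have "dotp Y y (mulv X M z) + dotp Y z (mulv X M y)
      = (\<Sum>i\<in>X. \<Sum>j\<in>X. y i * z j * (m i j + m j i))"
    unfolding expand[of y z] sum.distrib[symmetric]
    by (simp add: distrib_left mult.commute[of "z _"])
  also have "\<dots> = (\<Sum>i\<in>X. \<Sum>j\<in>X. y i * z j * of_bool (i \<noteq> j \<and> i \<in> K \<and> j \<in> K))"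
    unfolding m_def using entries by (intro sum.cong refl arg_cong[where f = "(*) _"]) auto
  also have "\<dots> = (\<Sum>i\<in>X. if i \<in> K then \<Sum>j\<in>K - {i}. y i * z j else 0)"
  proof (rule sum.cong)
    fix i assume "i \<in> X"
    show "(\<Sum>j\<in>X. y i * z j * of_bool (i \<noteq> j \<and> i \<in> K \<and> j \<in> K)) = (if i \<in> K then \<Sum>j\<in>K - {i}. y i * z j else 0)"
    proof (cases "i \<in> K")
      case True
      have "(\<Sum>j\<in>X. y i * z j * of_bool (i \<noteq> j \<and> i \<in> K \<and> j \<in> K))
        = (\<Sum>j\<in>K - {i}. y i * z j * of_bool (i \<noteq> j \<and> i \<in> K \<and> j \<in> K))"
        using X K by (intro sum.mono_neutral_right) auto
      also have "\<dots> = (\<Sum>j\<in>K - {i}. y i * z j)"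
        using True by (intro sum.cong) auto
      finally show ?thesis
        using True by simp
    qed simp
  qed simp
  also have "\<dots> = offdiag_form K y z"
    unfolding offdiag_form_def using X K
    by (subst sum.inter_restrict[symmetric]) (auto simp: Int_absorb1)
  finally show ?thesis .
qed

text \<open>An admissible change leaves row 0 and column 0 alone, so the correction
  \<open>A i 0 * A 0 j\<close> is unaffected and the Schur complement shifts by the same amount as
  the matrix.\<close>

lemma bit_family_schur:
  assumes S: "is_rule S" and Y: "Y \<subseteq> {1..<r}" and K: "K \<subseteq> {1..<r}"
    and closed: "\<And>A D. A \<in> family S r \<Longrightarrow> (\<And>i j. i \<notin> {1..<r} \<or> j \<notin> Y \<Longrightarrow> D i j = 0) \<Longrightarrow>
      (\<And>i j. i \<in> Y \<Longrightarrow> j \<in> Y \<Longrightarrow> D i j = D j i) \<Longrightarrow> A + D \<in> family S r"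
    and entries: "\<And>A i j. A \<in> family S r \<Longrightarrow> i \<in> {1..<r} \<Longrightarrow> j \<in> {1..<r} \<Longrightarrow>
      (if i \<in> Y then schur A i j else 0) + (if j \<in> Y then schur A j i else 0) = of_bool (i \<noteq> j \<and> i \<in> K \<and> j \<in> K)"
    and regular: "\<And>A u. A \<in> family S r \<Longrightarrow> u \<in> vecs ({1..<r} - Y) \<Longrightarrow> mulv {1..<r} (schur A) u = 0 \<Longrightarrow> u = 0"
  shows "bit_family {1..<r} Y K (family S r) schur"
proof
  fix A b w c
  assume A: "A \<in> family S r" and b: "b \<in> vecs {1..<r}" and w: "w \<in> vecs Y"
  have zero: "symm Y b w c i j = 0" if "i \<notin> {1..<r} \<or> j \<notin> Y" for i j
  proof -
    have "b i = 0 \<and> w i = 0" if "i \<notin> {1..<r}"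
      using b w Y that by (auto simp: vecs_def)
    moreover have "w j = 0" if "j \<notin> Y"
      using w that by (simp add: vecs_def)
    ultimately show ?thesis
      using that by (auto simp: symm_def)
  qed
  show "A + symm Y b w c \<in> family S r"
  proof (rule closed[OF A zero])
    fix i j assume "i \<in> Y" "j \<in> Y"
    then show "symm Y b w c i j = symm Y b w c j i"
      unfolding symm_def by (simp add: mult.commute[of "b i"] mult.commute[of "b j"] mult.assoc mult.commute[of "w i" "w j"] add.commute)
  qed assumption
  fix i j assume "i \<in> {1..<r}" "j \<in> {1..<r}"
  have "symm Y b w c i 0 = 0" "symm Y b w c 0 j = 0"
    using Y by (auto intro!: zero)
  then show "schur (A + symm Y b w c) i j = schur A i j + symm Y b w c i j"
    unfolding schur_def by (simp add: add.assoc add.commute[of "symm Y b w c i j"])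
next
  fix A y z assume A: "A \<in> family S r"
  show "dotp Y y (mulv {1..<r} (schur A) z) + dotp Y z (mulv {1..<r} (schur A) y) = offdiag_form K y z"
    by (rule offdiag_form_entries[OF _ Y K entries[OF A]]) simp
qed (use Y K finite_family[OF S] family_nonempty[OF S] regular in auto)

section \<open>From the family of matrices to the norm bound\<close>

lemma sum_corank_dist:
  assumes S: "is_rule S"
  shows "(\<Sum>x\<le>r. corank_dist S r x * g x)
    = (\<Sum>A\<in>family S r. g (kernel_dim (mat_of r A))) / real (card (family S r))"
    and "x > r \<Longrightarrow> corank_dist S r x = 0"
proof -
  have le: "kernel_dim (mat_of r A) \<le> r" for A
  proof -
    have "card (kern {..<r} A) \<le> card (vecs {..<r})"
      by (intro card_mono) (auto simp: kern_def)
    then have "(2::nat) ^ kernel_dim (mat_of r A) \<le> 2 ^ r"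
      by (simp add: card_mat_kernel_mat_of card_vecs)
    then show ?thesis
      by simp
  qed
  show "corank_dist S r x = 0" if "x > r"
  proof -
    have "{A \<in> family S r. kernel_dim (mat_of r A) = x} = {}"
      using le that by (auto simp: not_le[symmetric])
    then show ?thesis
      unfolding corank_dist_eq_family[OF S] by (simp only: card.empty of_nat_0 div_0)
  qed
  have "(\<Sum>x\<le>r. corank_dist S r x * g x)
      = (\<Sum>x\<le>r. \<Sum>A\<in>{A \<in> family S r. kernel_dim (mat_of r A) = x}. g (kernel_dim (mat_of r A)) / real (card (family S r)))"
    unfolding corank_dist_eq_family[OF S] by (intro sum.cong) simp_all
  also have "\<dots> = (\<Sum>A\<in>family S r. g (kernel_dim (mat_of r A)) / real (card (family S r)))"
    using le by (intro sum.group finite_family[OF S]) auto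
  finally show "(\<Sum>x\<le>r. corank_dist S r x * g x)
    = (\<Sum>A\<in>family S r. g (kernel_dim (mat_of r A))) / real (card (family S r))"
    by (simp add: sum_divide_distrib)
qed

text \<open>128 = 16 * 8 joins the constants of \<open>distribution_close\<close> and
  \<open>moment_close\<close>. One factor \<open>1 - 1 / sqrt 2\<close> stems from the series over
  \<open>m\<close> in the inversion, the other from the sum over \<open>j\<close> in the
  norm.\<close>

definition close_const :: real where
  "close_const = 128 / (1 - 1 / sqrt 2)\<^sup>2"

lemma close_const_ge: "close_const \<ge> 128" and close_const_pos: "close_const > 0"
proof -
  have "(1 - 1 / sqrt 2)\<^sup>2 \<le> 1" "(1 - 1 / sqrt 2)\<^sup>2 > 0"
    by (auto intro!: power_le_one)
  then show "close_const \<ge> 128"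
    by (simp add: close_const_def le_divide_eq)
  then show "close_const > 0"
    by simp
qed

lemma corank_dist_close:
  assumes S: "is_rule S" and r: "r > 0"
    and fam: "bit_family {1..<r} Y K (family S r) schur"
    and corner: "\<And>A. A \<in> family S r \<Longrightarrow> A 0 0 = 1"
    and off: "card ({1..<r} - Y) \<le> 1"
  shows "l1_norm (\<lambda>j. corank_dist S r j - pi_CL j) \<le> ennreal (close_const * (1 / sqrt 2) ^ card K)"
proof -
  interpret bit_family "{1..<r}" Y K "family S r" schur
    by (rule fam)
  define E where "E = 8 * (1 / sqrt 2) ^ card K"
  have "card (kern {1..<r} (schur A)) = 2 ^ kernel_dim (mat_of r A)" if "A \<in> family S r" for A
    using card_kern_schur[of A r] corner[OF that] r card_mat_kernel_mat_of[of r A] by simp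
  then have "\<bar>(\<Sum>x\<le>r. corank_dist S r x * inj_count k x) - 1\<bar> \<le> E * sqrt 2 ^ (k * k)" for k
    unfolding sum_corank_dist(1)[OF S] E_def by (rule moment_close[OF _ off])
  then have "\<bar>corank_dist S r j - pi_CL j\<bar> \<le> 16 * E / (1 - 1 / sqrt 2) * (1 / sqrt 2) ^ (j * j)" for j
    by (rule distribution_close[where P = "corank_dist S r" and n = r, rotated]) (rule sum_corank_dist(2)[OF S])
  then have "l1_norm (\<lambda>j. corank_dist S r j - pi_CL j) \<le> ennreal (16 * E / (1 - 1 / sqrt 2) / (1 - 1 / sqrt 2))"
    by (rule l1_norm_le) (simp add: E_def)
  also have "16 * E / (1 - 1 / sqrt 2) / (1 - 1 / sqrt 2) = close_const * (1 / sqrt 2) ^ card K"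
    by (simp add: E_def close_const_def power2_eq_square)
  finally show ?thesis .
qed

text \<open>\<open>distribution_close\<close> applies to \<open>P = 0\<close>: its moments are all
  0, at distance 1 from 1, so \<open>E = 1\<close> is admissible.\<close>

lemma l1_norm_pi_CL: "l1_norm (\<lambda>j. 0 - pi_CL j) \<le> ennreal (close_const / 8)"
proof -
  have "\<bar>(\<Sum>x\<le>0. 0 * inj_count k x) - 1\<bar> \<le> 1 * sqrt 2 ^ (k * k)" for k
    by simp
  then have "\<bar>0 - pi_CL j\<bar> \<le> 16 * 1 / (1 - 1 / sqrt 2) * (1 / sqrt 2) ^ (j * j)" for j
    by (rule distribution_close[rotated]) simp
  then have "l1_norm (\<lambda>j. 0 - pi_CL j) \<le> ennreal (16 * 1 / (1 - 1 / sqrt 2) / (1 - 1 / sqrt 2))"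
    by (rule l1_norm_le) simp
  also have "16 * 1 / (1 - 1 / sqrt 2) / (1 - 1 / sqrt 2) = close_const / 8"
    by (simp add: close_const_def power2_eq_square)
  finally show ?thesis .
qed

text \<open>A crude bound for the cases left out by the moments: \<open>r = 0\<close>, and in the
  third rule \<open>\<kappa> \<le> 1\<close>, where column 1 of the Schur complement may
  vanish.\<close>

lemma corank_dist_bounded:
  assumes S: "is_rule S"
  shows "l1_norm (\<lambda>j. corank_dist S r j - pi_CL j) \<le> ennreal close_const"
proof -
  have "l1_norm (corank_dist S r) = (\<Sum>j\<le>r. ennreal \<bar>corank_dist S r j\<bar>)"
    unfolding l1_norm_def using sum_corank_dist(2)[OF S]
    by (intro suminf_finite) (auto simp: not_le)
  also have "\<dots> = (\<Sum>j\<le>r. ennreal (corank_dist S r j * 1))"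
    by (simp add: corank_dist_def)
  also have "\<dots> = ennreal (\<Sum>j\<le>r. corank_dist S r j * 1)"
    by (rule sum_ennreal) (simp add: corank_dist_def)
  also have "(\<Sum>j\<le>r. corank_dist S r j * 1) = 1"
    unfolding sum_corank_dist(1)[OF S] using finite_family[OF S] family_nonempty[OF S] by simp
  finally have "l1_norm (corank_dist S r) = ennreal 1" .
  moreover have "l1_norm (\<lambda>j. corank_dist S r j - pi_CL j) \<le> l1_norm (corank_dist S r) + l1_norm (\<lambda>j. 0 - pi_CL j)"
    using l1_norm_triangle[of "corank_dist S r" pi_CL] by (simp add: l1_norm_def)
  ultimately have "l1_norm (\<lambda>j. corank_dist S r j - pi_CL j) \<le> ennreal 1 + ennreal (close_const / 8)"
    using l1_norm_pi_CL by (metis add_left_mono order_trans)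
  also have "\<dots> = ennreal (1 + close_const / 8)"
    using close_const_pos by (intro ennreal_plus[symmetric]) auto
  also have "\<dots> \<le> ennreal close_const"
    using close_const_ge by (intro ennreal_leI) simp
  finally show ?thesis .
qed

section \<open>The Pell rules\<close>

lemma card_truncated: "card ({1..m} \<inter> {1..<r}) = min m (r - 1)"
proof -
  have "{1..m} \<inter> {1..<r} = {1..min m (r - 1)}"
    by auto
  then show ?thesis
    by simp
qed

text \<open>By \<open>uv\<close> the corrections \<open>A i 0 * A 0 j\<close> and
  \<open>A j 0 * A 0 i\<close> cancel, so passing to the Schur complement keeps the alternating
  part. For j < i, the condition \<open>i \<le> m\<close> says that both indices lie in
  \<open>?K\<close>.\<close>

lemma corank_dist_close_symmetric:
  fixes u v :: "nat \<Rightarrow> bit"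
  assumes S: "is_rule S" and r: "r > 0"
    and first: "\<And>A. encode A 0 \<in> S 0 \<longleftrightarrow> A 0 0 = 1"
    and step: "\<And>A i. i > 0 \<Longrightarrow> encode A i \<in> S i \<longleftrightarrow>
      A i 0 = u i \<and> A 0 i = v i \<and> (\<forall>j. 0 < j \<and> j < i \<longrightarrow> A i j + A j i = of_bool (i \<le> m))"
    and uv: "\<And>i j. u i * v j = u j * v i"
  shows "l1_norm (\<lambda>j. corank_dist S r j - pi_CL j) \<le> ennreal (close_const * (1 / sqrt 2) ^ min m (r - 1))"
proof -
  let ?X = "{1..<r}"
  let ?K = "{1..m} \<inter> ?X"
  have mem: "A \<in> family S r \<longleftrightarrow> (\<forall>i j. i \<ge> r \<or> j \<ge> r \<longrightarrow> A i j = 0) \<and> A 0 0 = 1 \<and>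
      (\<forall>i. 0 < i \<and> i < r \<longrightarrow> A i 0 = u i \<and> A 0 i = v i \<and>
        (\<forall>j. 0 < j \<and> j < i \<longrightarrow> A i j + A j i = of_bool (i \<le> m)))" for A
  proof -
    have "(\<forall>i<r. encode A i \<in> S i) \<longleftrightarrow> encode A 0 \<in> S 0 \<and> (\<forall>i. 0 < i \<and> i < r \<longrightarrow> encode A i \<in> S i)"
      using r by (metis gr0I)
    then show ?thesis
      unfolding family_def using first[of A] step[of _ A] by auto
  qed
  have "bit_family ?X ?X ?K (family S r) schur"
  proof (rule bit_family_schur[OF S])
    fix A D :: "nat \<Rightarrow> nat \<Rightarrow> bit"
    assume A: "A \<in> family S r"
      and D0: "\<And>i j. i \<notin> ?X \<or> j \<notin> ?X \<Longrightarrow> D i j = 0"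
      and D: "\<And>i j. i \<in> ?X \<Longrightarrow> j \<in> ?X \<Longrightarrow> D i j = D j i"
    have "(A + D) i j + (A + D) j i = A i j + A j i" if "0 < j" "j < i" "i < r" for i j
    proof -
      have "D i j = D j i"
        using that by (intro D) auto
      then have "(A + D) i j + (A + D) j i = (A i j + A j i) + (D j i + D j i)"
        by (simp only: plus_fun_apply add.assoc add.left_commute)
      then show ?thesis
        by simp
    qed
    moreover have "D i 0 = 0" "D 0 i = 0" for i
      by (auto intro: D0)
    moreover have "D i j = 0" if "i \<ge> r \<or> j \<ge> r" for i j
      using that by (intro D0) auto
    ultimately show "A + D \<in> family S r"
      using A unfolding mem by (simp del: plus_fun_apply) simp
  next
    fix A i j assume A: "A \<in> family S r" and ij: "i \<in> ?X" "j \<in> ?X"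
    have lower: "schur A i j + schur A j i = of_bool (i \<noteq> j \<and> i \<in> ?K \<and> j \<in> ?K)"
      if "j < i" "i \<in> ?X" "j \<in> ?X" for i j
    proof -
      have a: "A i 0 = u i" "A j 0 = u j" "A 0 i = v i" "A 0 j = v j" "A i j + A j i = of_bool (i \<le> m)"
        using A that unfolding mem by auto
      have "schur A i j + schur A j i = (A i j + A j i) + (u i * v j + u j * v i)"
        unfolding schur_def a(1-4) by (simp only: add.assoc add.left_commute)
      also have "\<dots> = of_bool (i \<le> m)"
        unfolding a(5) uv[of j i] by simp
      finally show ?thesis
        using that by auto
    qed
    have "schur A i j + schur A j i = of_bool (i \<noteq> j \<and> i \<in> ?K \<and> j \<in> ?K)"
    proof (cases i j rule: linorder_cases)
      case less
      have "schur A i j + schur A j i = schur A j i + schur A i j"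
        by (rule add.commute)
      also have "\<dots> = of_bool (j \<noteq> i \<and> j \<in> ?K \<and> i \<in> ?K)"
        by (rule lower[OF less ij(2,1)])
      finally show ?thesis
        by (simp only: conj_commute[of "j \<in> ?K"] eq_commute[of j i])
    next
      case equal
      then show ?thesis
        by simp
    next
      case greater
      then show ?thesis
        by (rule lower[OF _ ij])
    qed
    then show "(if i \<in> ?X then schur A i j else 0) + (if j \<in> ?X then schur A j i else 0)
      = of_bool (i \<noteq> j \<and> i \<in> ?K \<and> j \<in> ?K)"
      using ij by (simp only: if_True)
  qed (auto simp: vecs_def)
  then have "l1_norm (\<lambda>j. corank_dist S r j - pi_CL j) \<le> ennreal (close_const * (1 / sqrt 2) ^ card ?K)"
    by (rule corank_dist_close[OF S r]) (auto simp: mem)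
  then show ?thesis
    by (simp only: card_truncated)
qed

lemma vec_add_eq_iff: "Matrix.vec i f + Matrix.vec i g = Matrix.vec i h \<longleftrightarrow> (\<forall>j<i. f j + g j = (h j :: bit))"
  by (auto simp: Matrix.vec_eq_iff)

lemma vec_eq_vec_iff: "Matrix.vec i f = Matrix.vec i g \<longleftrightarrow> (\<forall>j<i. f j + g j = (0 :: bit))"
  by (auto simp: Matrix.vec_eq_iff bit_add_eq_0_iff)

lemma all_less_split_0: "i > 0 \<Longrightarrow> (\<forall>j<i. P j) \<longleftrightarrow> P 0 \<and> (\<forall>j. 0 < j \<and> j < i \<longrightarrow> P j)" for i :: nat
  by (metis gr0I)

lemma bit_add_eq_1_iff: "x + y = 1 \<longleftrightarrow> x = y + 1" for x y :: bit
  by (cases x; cases y) auto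

text \<open>For \<open>i > 0\<close>, \<open>i \<le> \<kappa> - 1\<close> means
  \<open>i < \<kappa>\<close>, also at \<open>\<kappa> = 0\<close>. Row 0 and column 0 agree, whence
  \<open>u = v\<close>.\<close>

lemma Pell1_close:
  assumes "r > 0"
  shows "l1_norm (\<lambda>j. corank_dist (Pell1 \<kappa>) r j - pi_CL j)
    \<le> ennreal (close_const * (1 / sqrt 2) ^ min (\<kappa> - 1) (r - 1))"
proof (rule corank_dist_close_symmetric[where u = "\<lambda>i. of_bool (i \<le> \<kappa> - 1)" and v = "\<lambda>i. of_bool (i \<le> \<kappa> - 1)"])
  show "encode A 0 \<in> Pell1 \<kappa> 0 \<longleftrightarrow> A 0 0 = 1" for A
    by (auto simp: encode_def Pell1_def)
  fix A :: "nat \<Rightarrow> nat \<Rightarrow> bit" and i :: nat assume i: "i > 0"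
  show "encode A i \<in> Pell1 \<kappa> i \<longleftrightarrow> A i 0 = of_bool (i \<le> \<kappa> - 1) \<and> A 0 i = of_bool (i \<le> \<kappa> - 1) \<and>
    (\<forall>j. 0 < j \<and> j < i \<longrightarrow> A i j + A j i = of_bool (i \<le> \<kappa> - 1))"
  proof (cases "i < \<kappa>")
    case True
    then have "encode A i \<in> Pell1 \<kappa> i \<longleftrightarrow>
        (\<forall>j<i. A i j + A j i = (if j = 0 then 0 else 1)) \<and> A 0 i = 1"
      using i by (simp add: encode_def Pell1_def vec_add_eq_iff)
    then show ?thesis
      using True i by (auto simp: all_less_split_0 bit_add_eq_0_iff)
  next
    case False
    then have "encode A i \<in> Pell1 \<kappa> i \<longleftrightarrow> (\<forall>j<i. A i j + A j i = 0) \<and> A i 0 = 0"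
      using i by (simp add: encode_def Pell1_def vec_eq_vec_iff)
    then show ?thesis
      using False i by (auto simp: all_less_split_0 bit_add_eq_0_iff)
  qed
qed (use assms is_rule_Pell1 in \<open>auto simp: mult.commute\<close>)

text \<open>For \<open>i \<le> \<kappa>\<close>, \<open>w $ 0 = 1\<close> together with the sum 1
  forces \<open>v $ 0 = 0\<close>; later steps set it to 0. So column 0 vanishes below the corner
  and \<open>u = 0\<close>.\<close>

lemma Pell2_close:
  assumes "r > 0"
  shows "l1_norm (\<lambda>j. corank_dist (Pell2 \<kappa>) r j - pi_CL j)
    \<le> ennreal (close_const * (1 / sqrt 2) ^ min \<kappa> (r - 1))"
proof (rule corank_dist_close_symmetric[where u = "\<lambda>_. 0" and v = "\<lambda>i. of_bool (i \<le> \<kappa>)"])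
  show "encode A 0 \<in> Pell2 \<kappa> 0 \<longleftrightarrow> A 0 0 = 1" for A
    by (auto simp: encode_def Pell2_def)
  fix A :: "nat \<Rightarrow> nat \<Rightarrow> bit" and i :: nat assume i: "i > 0"
  show "encode A i \<in> Pell2 \<kappa> i \<longleftrightarrow> A i 0 = 0 \<and> A 0 i = of_bool (i \<le> \<kappa>) \<and>
    (\<forall>j. 0 < j \<and> j < i \<longrightarrow> A i j + A j i = of_bool (i \<le> \<kappa>))"
  proof (cases "i \<le> \<kappa>")
    case True
    then have "encode A i \<in> Pell2 \<kappa> i \<longleftrightarrow> (\<forall>j<i. A i j + A j i = 1) \<and> A 0 i = 1"
      using i by (simp add: encode_def Pell2_def vec_add_eq_iff)
    then show ?thesis
      using True i by (auto simp: all_less_split_0 bit_add_eq_1_iff[of "A i 0"])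
  next
    case False
    then have "encode A i \<in> Pell2 \<kappa> i \<longleftrightarrow> (\<forall>j<i. A i j + A j i = 0) \<and> A i 0 = 0"
      using i by (simp add: encode_def Pell2_def vec_eq_vec_iff)
    then show ?thesis
      using False i by (auto simp: all_less_split_0 bit_add_eq_0_iff)
  qed
qed (use assms is_rule_Pell2 in auto)

text \<open>For \<open>i \<ge> 2\<close> the rule fixes \<open>A i 1\<close> but leaves
  \<open>A 1 i\<close> free, hence \<open>Y\<close> omits the index 1; through the fixed column this
  index still belongs to \<open>?K\<close>. From \<open>\<kappa> \<ge> 2\<close> comes
  \<open>A 2 1 = 1\<close>, so column 1 of the Schur complement is nonzero, which is
  \<open>regular\<close>. As \<open>A i 0 = 0\<close> for \<open>i \<ge> 2\<close>, the complement
  changes no row in \<open>Y\<close>.\<close>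

lemma Pell3_close:
  assumes \<kappa>: "2 \<le> \<kappa>" "\<kappa> < r"
  shows "l1_norm (\<lambda>j. corank_dist (Pell3 a b \<kappa>) r j - pi_CL j)
    \<le> ennreal (close_const * (1 / sqrt 2) ^ \<kappa>)"
proof -
  let ?X = "{1..<r}" and ?Y = "{2..<r}" and ?K = "{1..\<kappa>}"
  let ?F = "family (Pell3 a b \<kappa>) r"
  have first: "encode A 0 \<in> Pell3 a b \<kappa> 0 \<longleftrightarrow> A 0 0 = 1" for A
    by (auto simp: encode_def Pell3_def)
  have second: "encode A 1 \<in> Pell3 a b \<kappa> 1 \<longleftrightarrow> A 1 0 = 1 \<and> A 0 1 = a \<and> A 1 1 = b" for A
    by (simp add: encode_def Pell3_def Matrix.vec_eq_iff)
  have step: "encode A i \<in> Pell3 a b \<kappa> i \<longleftrightarrow> A i 0 = 0 \<and> A 0 i = 1 \<and> A i 1 = of_bool (i \<le> \<kappa>) \<and>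
      (\<forall>j. 2 \<le> j \<and> j < i \<longrightarrow> A i j + A j i = of_bool (i \<le> \<kappa>))" if "2 \<le> i" for A i
    using that by (cases "i \<le> \<kappa>") (auto simp: encode_def Pell3_def)
  have mem: "A \<in> ?F \<longleftrightarrow> (\<forall>i j. i \<ge> r \<or> j \<ge> r \<longrightarrow> A i j = 0) \<and> A 0 0 = 1 \<and>
      (A 1 0 = 1 \<and> A 0 1 = a \<and> A 1 1 = b) \<and>
      (\<forall>i. 2 \<le> i \<and> i < r \<longrightarrow> A i 0 = 0 \<and> A 0 i = 1 \<and> A i 1 = of_bool (i \<le> \<kappa>) \<and>
        (\<forall>j. 2 \<le> j \<and> j < i \<longrightarrow> A i j + A j i = of_bool (i \<le> \<kappa>)))" for A
  proof -
    have split: "(\<forall>i<r. P i) \<longleftrightarrow> P 0 \<and> P 1 \<and> (\<forall>i. 2 \<le> i \<and> i < r \<longrightarrow> P i)" for P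
    proof safe
      fix i assume "P 0" "P 1" "\<forall>i. 2 \<le> i \<and> i < r \<longrightarrow> P i" "i < r"
      then show "P i"
        by (cases "i = 0 \<or> i = 1") auto
    qed (use \<kappa> in auto)
    have "(\<forall>i. 2 \<le> i \<and> i < r \<longrightarrow> encode A i \<in> Pell3 a b \<kappa> i) \<longleftrightarrow>
      (\<forall>i. 2 \<le> i \<and> i < r \<longrightarrow> A i 0 = 0 \<and> A 0 i = 1 \<and> A i 1 = of_bool (i \<le> \<kappa>) \<and>
        (\<forall>j. 2 \<le> j \<and> j < i \<longrightarrow> A i j + A j i = of_bool (i \<le> \<kappa>)))"
      using step[of _ A] by blast
    then show ?thesis
      unfolding family_def mem_Collect_eq split first second by blast
  qed
  have "bit_family ?X ?Y ?K ?F schur"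
  proof (rule bit_family_schur[OF is_rule_Pell3])
    fix A D :: "nat \<Rightarrow> nat \<Rightarrow> bit"
    assume A: "A \<in> ?F"
      and D0: "\<And>i j. i \<notin> ?X \<or> j \<notin> ?Y \<Longrightarrow> D i j = 0"
      and D: "\<And>i j. i \<in> ?Y \<Longrightarrow> j \<in> ?Y \<Longrightarrow> D i j = D j i"
    have "(A + D) i j + (A + D) j i = A i j + A j i" if "2 \<le> j" "j < i" "i < r" for i j
    proof -
      have "D i j = D j i"
        using that by (intro D) auto
      then have "(A + D) i j + (A + D) j i = (A i j + A j i) + (D j i + D j i)"
        by (simp only: plus_fun_apply add.assoc add.left_commute)
      then show ?thesis
        by simp
    qed
    moreover have "(A + D) i 0 = A i 0" "(A + D) 0 i = A 0 i" "(A + D) i 1 = A i 1" for i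
      using D0[of i 0] D0[of 0 i] D0[of i 1] by auto
    moreover have "(A + D) i j = A i j" if "i \<ge> r \<or> j \<ge> r" for i j
      using that D0[of i j] by auto
    ultimately show "A + D \<in> ?F"
      using A unfolding mem by (simp del: plus_fun_apply One_nat_def)
  next
    fix A i j assume A: "A \<in> ?F" and ij: "i \<in> ?X" "j \<in> ?X"
    define m where "m i j = (if i \<in> ?Y then schur A i j else 0)" for i j
    have lower: "m i j + m j i = of_bool (i \<noteq> j \<and> i \<in> ?K \<and> j \<in> ?K)"
      if "j < i" "i \<in> ?X" "j \<in> ?X" for i j
    proof -
      have i: "2 \<le> i" "i < r"
        using that by auto
      then have a: "A i 0 = 0" "A i 1 = of_bool (i \<le> \<kappa>)"
        using A unfolding mem by auto
      show ?thesis
      proof (cases "j = 1")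
        case True
        then have "m i j + m j i = of_bool (i \<le> \<kappa>)"
          using i a by (simp add: m_def schur_def)
        then show ?thesis
          using True that by auto
      next
        case False
        then have j: "2 \<le> j" "j < r"
          using that by auto
        then have "A j 0 = 0" "A i j + A j i = of_bool (i \<le> \<kappa>)"
          using A i that(1) unfolding mem by auto
        then have "m i j + m j i = of_bool (i \<le> \<kappa>)"
          using i j a by (simp add: m_def schur_def)
        then show ?thesis
          using that by auto
      qed
    qed
    have "m i j + m j i = of_bool (i \<noteq> j \<and> i \<in> ?K \<and> j \<in> ?K)"
    proof (cases i j rule: linorder_cases)
      case less
      have "m i j + m j i = m j i + m i j"
        by (rule add.commute)
      also have "\<dots> = of_bool (j \<noteq> i \<and> j \<in> ?K \<and> i \<in> ?K)"
        by (rule lower[OF less ij(2,1)])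
      finally show ?thesis
        by (simp only: conj_commute[of "j \<in> ?K"] eq_commute[of j i])
    next
      case equal
      then show ?thesis
        by simp
    next
      case greater
      then show ?thesis
        by (rule lower[OF _ ij])
    qed
    then show "(if i \<in> ?Y then schur A i j else 0) + (if j \<in> ?Y then schur A j i else 0)
      = of_bool (i \<noteq> j \<and> i \<in> ?K \<and> j \<in> ?K)"
      unfolding m_def .
  next
    fix A u assume A: "A \<in> ?F" and u: "u \<in> vecs (?X - ?Y)" and ker: "mulv ?X (schur A) u = 0"
    have u0: "u j = 0" if "j \<noteq> 1" for j
      using u that by (auto simp: vecs_def)
    have "schur A 2 1 = 1"
      using A \<kappa> unfolding mem by (simp add: schur_def del: One_nat_def)
    moreover have "(\<Sum>j\<in>?X. schur A 2 j * u j) = (\<Sum>j\<in>{1}. schur A 2 j * u j)"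
      using \<kappa> u0 by (intro sum.mono_neutral_right) auto
    moreover have "(\<Sum>j\<in>?X. schur A 2 j * u j) = mulv ?X (schur A) u 2"
      using \<kappa> by (simp add: mulv_def)
    ultimately have "u 1 = 0"
      using ker by simp
    then show "u = 0"
      using u0 by (metis ext zero_fun_apply)
  qed (use \<kappa> in auto)
  moreover have "card (?X - ?Y) \<le> 1"
  proof -
    have "?X - ?Y \<subseteq> {1}"
      by auto
    then show ?thesis
      using card_mono[of "{1::nat}" "?X - ?Y"] by simp
  qed
  ultimately have "l1_norm (\<lambda>j. corank_dist (Pell3 a b \<kappa>) r j - pi_CL j)
      \<le> ennreal (close_const * (1 / sqrt 2) ^ card ?K)"
    using \<kappa> by (intro corank_dist_close[OF is_rule_Pell3]) (auto simp: mem)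
  then show ?thesis
    by simp
qed

text \<open>The exponents \<open>min (\<kappa> - 1) (r - 1)\<close> and
  \<open>min \<kappa> (r - 1)\<close> fall short of \<open>\<kappa> \<le> r\<close> by at most one,
  which costs a factor sqrt 2 \<le> 2.\<close>

lemma close_weaken:
  assumes "x \<le> ennreal (close_const * (1 / sqrt 2) ^ k)" "n \<le> k + 1"
  shows "x \<le> ennreal (2 * close_const * (1 / sqrt 2) ^ n)"
proof -
  have "(1 / sqrt 2) ^ (k + 1) \<le> (1 / sqrt 2) ^ n"
    using assms(2) by (intro power_decreasing) auto
  moreover have "(1 / sqrt 2) ^ k \<le> 2 * (1 / sqrt 2) ^ (k + 1)"
  proof -
    have "sqrt 2 \<le> 2"
      by (rule real_le_lsqrt) auto
    then have "1 \<le> 2 / sqrt 2"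
      by simp
    then have "(1 / sqrt 2) ^ k * 1 \<le> (1 / sqrt 2) ^ k * (2 / sqrt 2)"
      by (rule mult_left_mono) simp
    then show ?thesis
      by (simp add: mult.commute)
  qed
  ultimately have "close_const * (1 / sqrt 2) ^ k \<le> close_const * (2 * (1 / sqrt 2) ^ n)"
    using close_const_pos by (intro mult_left_mono) auto
  then have "close_const * (1 / sqrt 2) ^ k \<le> 2 * close_const * (1 / sqrt 2) ^ n"
    by simp
  then show ?thesis
    using assms(1) by (meson ennreal_leI order_trans)
qed

lemma corank_dist_close_small:
  assumes "is_rule S" "n \<le> 1"
  shows "l1_norm (\<lambda>j. corank_dist S r j - pi_CL j) \<le> ennreal (2 * close_const * (1 / sqrt 2) ^ n)"
  using assms by (intro close_weaken[where k = 0]) (simp_all add: corank_dist_bounded)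

theorem theorem4p8:
  shows "\<exists>C \<rho> :: real. C > 0 \<and> \<rho> \<in> {0<..<1} \<and>
    (\<forall>r. \<forall>\<mu> \<in> {mu_Pell1, mu_Pell2}.
       l1_norm (\<lambda>j. \<mu> r j - pi_CL j) \<le> ennreal (C * \<rho> ^ r)) \<and>
    (\<forall>r. \<forall>a b :: bit.
       l1_norm (\<lambda>j. mu_Pell3 a b r j - pi_CL j) \<le> ennreal (C * \<rho> ^ r))"
proof -
  define \<rho> :: real where "\<rho> = (1 + 1 / sqrt 2) / 2"
  \<comment> \<open>One factor 2 is that of \<open>close_weaken\<close>; the other pays for the
    third rule averaging over \<open>r - 1\<close> instead of \<open>r\<close>, as 1 / \<rho> \<le>
    2.\<close>
  define C where "C = 4 * close_const"
  have \<rho>: "1 / 2 \<le> \<rho>" "\<rho> < 1"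
    by (simp_all add: \<rho>_def)
  have C: "C > 0"
    using close_const_pos by (simp add: C_def)
  have pell12: "l1_norm (\<lambda>j. (\<Sum>\<kappa>\<le>r. Binom r \<kappa> * corank_dist (S \<kappa>) r j) - pi_CL j) \<le> ennreal (C * \<rho> ^ r)"
    if S: "\<And>\<kappa>. is_rule (S \<kappa>)" and close: "\<And>\<kappa>. r > 0 \<Longrightarrow> \<kappa> \<le> r \<Longrightarrow>
      l1_norm (\<lambda>j. corank_dist (S \<kappa>) r j - pi_CL j) \<le> ennreal (2 * close_const * (1 / sqrt 2) ^ \<kappa>)"
    for S r
  proof -
    have "l1_norm (\<lambda>j. (\<Sum>\<kappa>\<le>r. Binom r \<kappa> * corank_dist (S \<kappa>) r j) - pi_CL j)
        \<le> ennreal (2 * close_const * \<rho> ^ r)"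
      unfolding \<rho>_def
    proof (rule l1_norm_binomial_mixture)
      fix \<kappa> assume "\<kappa> \<le> r"
      then show "l1_norm (\<lambda>j. corank_dist (S \<kappa>) r j - pi_CL j) \<le> ennreal (2 * close_const * (1 / sqrt 2) ^ \<kappa>)"
        using close corank_dist_close_small[OF S, of \<kappa> r \<kappa>] by (cases "r > 0") auto
    qed (use close_const_pos in auto)
    also have "\<dots> \<le> ennreal (C * \<rho> ^ r)"
      using close_const_pos \<rho> by (intro ennreal_leI mult_right_mono) (auto simp: C_def)
    finally show ?thesis .
  qed
  have pell1: "l1_norm (\<lambda>j. mu_Pell1 r j - pi_CL j) \<le> ennreal (C * \<rho> ^ r)" for r
    unfolding mu_Pell1_def atLeast0AtMost
    by (rule pell12[OF is_rule_Pell1]) (auto intro: close_weaken[OF Pell1_close])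
  have pell2: "l1_norm (\<lambda>j. mu_Pell2 r j - pi_CL j) \<le> ennreal (C * \<rho> ^ r)" for r
    unfolding mu_Pell2_def atLeast0AtMost
    by (rule pell12[OF is_rule_Pell2]) (auto intro: close_weaken[OF Pell2_close])
  have pell3: "l1_norm (\<lambda>j. mu_Pell3 a b r j - pi_CL j) \<le> ennreal (C * \<rho> ^ r)" for r a b
  proof (cases r)
    case 0
    have "l1_norm (\<lambda>j. 0 - pi_CL j) \<le> ennreal (close_const / 8)"
      by (rule l1_norm_pi_CL)
    also have "\<dots> \<le> ennreal C"
      using close_const_pos by (intro ennreal_leI) (simp add: C_def)
    finally show ?thesis
      by (simp add: 0 mu_Pell3_def)
  next
    case (Suc n)
    have "l1_norm (\<lambda>j. (\<Sum>\<kappa>\<le>n. Binom n \<kappa> * corank_dist (Pell3 a b \<kappa>) r j) - pi_CL j)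
        \<le> ennreal (2 * close_const * \<rho> ^ n)"
      unfolding \<rho>_def
    proof (rule l1_norm_binomial_mixture)
      fix \<kappa> assume "\<kappa> \<le> n"
      show "l1_norm (\<lambda>j. corank_dist (Pell3 a b \<kappa>) r j - pi_CL j) \<le> ennreal (2 * close_const * (1 / sqrt 2) ^ \<kappa>)"
      proof (cases "\<kappa> \<le> 1")
        case True
        then show ?thesis
          by (rule corank_dist_close_small[OF is_rule_Pell3])
      next
        case False
        then show ?thesis
          using \<open>\<kappa> \<le> n\<close> Suc by (intro close_weaken[OF Pell3_close]) auto
      qed
    qed (use close_const_pos in auto)
    also have "2 * close_const * \<rho> ^ n \<le> C * \<rho> ^ r"
    proof -
      have "2 * close_const * \<rho> ^ n * 1 \<le> 2 * close_const * \<rho> ^ n * (2 * \<rho>)"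
        using \<rho> close_const_pos by (intro mult_left_mono) auto
      then show ?thesis
        by (simp add: Suc C_def)
    qed
    then have "ennreal (2 * close_const * \<rho> ^ n) \<le> ennreal (C * \<rho> ^ r)"
      by (rule ennreal_leI)
    finally show ?thesis
      by (simp add: mu_Pell3_def Suc lessThan_Suc_atMost)
  qed
  show ?thesis
    using C \<rho> pell1 pell2 pell3 by (intro exI[of _ C] exI[of _ \<rho>]) auto
qed

end
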